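(* Let $\Lambda>0$, $T>0$, $J\in\mathbb R$, and set $b=\tfrac32J\Lambda$. Consider on $\mathbb S^2\times\mathbb S^1$ the equation $$-\frac{\partial^2\phi}{\partial\alpha^2}-\Big({}^2\Delta-\frac14\Big)\phi-\frac14\phi^5-\frac{b^2\sin^2\theta}{\phi^7}=0,\qquad(\ast)$$ where $\alpha$ is the coordinate along the circle $\mathbb S^1=\mathbb R/T\mathbb Z$ of length $T$, ${}^2\Delta$ is the Laplacian on the round unit sphere $\mathbb S^2$, and $\theta\in[0,\pi]$ is the polar angle on $\mathbb S^2$. (1) If $T\le2\pi$ and $\Lambda|J|<0.05$, then $(\ast)$ has a smooth, positive solution. The same applies if $T\ge2\pi$ and $\Lambda|J|<2.01/T^2$. (2) If $\Lambda|J|>0.165$, then $(\ast)$ has no smooth, positive solution.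
   Context: Equation $(\ast)$ is, up to the overall factor $\Lambda$, the Lichnerowicz equation $-(\Delta-\frac18R)\phi-\frac14\Lambda\phi^5-\frac{\Omega^2}{8\phi^7}=0$ on $\mathbb S^2\times\mathbb S^1$ with the metric $ds^2=\Lambda^{-1}(d\alpha^2+d\theta^2+\sin^2\theta\,d\varphi^2)$, $\alpha\in[0,T]$ periodically identified (scalar curvature $R=2\Lambda$), with Bowen–York second fundamental form whose only non-vanishing component is $K_{\alpha\varphi}=3J\Lambda^{1/2}\sin^2\theta$, so that $\Omega^2=K_{ij}K^{ij}=18J^2\Lambda^3\sin^2\theta$. The number $J$ is the angular momentum of the $\mathbb S^2$ slices. *)

theory Defs
  imports "HOL-Analysis.Analysis"
begin

text \<open>
  The sphere is \<open>sphere 0 1\<close> in \<open>real^3\<close>, and a function on the product of the sphere with the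
  circle of length \<open>T\<close> is a function \<open>\<phi> x \<alpha>\<close> that is \<open>T\<close>-periodic in \<open>\<alpha>\<close>; its values at points
  \<open>x\<close> off the sphere are irrelevant.
\<close>

primrec times_differentiable_on ::
    "nat \<Rightarrow> ('a::real_normed_vector \<Rightarrow> real) \<Rightarrow> 'a set \<Rightarrow> bool" where
  "times_differentiable_on 0 f U \<longleftrightarrow> continuous_on U f"
| "times_differentiable_on (Suc n) f U \<longleftrightarrow>
     (\<forall>x\<in>U. f differentiable (at x)) \<and>
     (\<forall>v. times_differentiable_on n (\<lambda>x. frechet_derivative f (at x) v) U)"

text \<open>Smoothness on an arbitrary subset \<open>M\<close> of a normed space is the existence of local smooth
  extensions; for an embedded submanifold \<open>M\<close> this is smoothness as a function on the manifold.\<close>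

definition smooth_on :: "('a::real_normed_vector \<Rightarrow> real) \<Rightarrow> 'a set \<Rightarrow> bool" where
  "smooth_on f M \<longleftrightarrow>
     (\<forall>p\<in>M. \<exists>U F. open U \<and> p \<in> U \<and> (\<forall>n. times_differentiable_on n F U) \<and>
        (\<forall>x\<in>M \<inter> U. F x = f x))"

text \<open>The Laplacian of the round unit sphere is the divergence of the gradient. Both are computed
  through the extension \<open>f \<circ> sgn\<close>, which is constant along rays (\<open>sgn y = y /\<^sub>R norm y\<close>) and
  only depends on the restriction of \<open>f\<close> to the sphere. As its radial derivative vanishes, its
  Euclidean gradient at a point of the sphere is the tangential gradient, and the Euclidean
  divergence of the same extension of a tangent field is the trace of its tangential derivative,
  i.e. its divergence for the round metric.\<close>

definition sphere_partial :: "3 \<Rightarrow> (real^3 \<Rightarrow> real) \<Rightarrow> real^3 \<Rightarrow> real" where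
  "sphere_partial i f x = frechet_derivative (f \<circ> sgn) (at x) (axis i 1)"

definition sphere_gradient :: "(real^3 \<Rightarrow> real) \<Rightarrow> real^3 \<Rightarrow> real^3" where
  "sphere_gradient f x = (\<chi> i. sphere_partial i f x)"

definition sphere_divergence :: "(real^3 \<Rightarrow> real^3) \<Rightarrow> real^3 \<Rightarrow> real" where
  "sphere_divergence X x = (\<Sum>i\<in>UNIV. sphere_partial i (\<lambda>y. X y $ i) x)"

definition sphere_laplacian :: "(real^3 \<Rightarrow> real) \<Rightarrow> real^3 \<Rightarrow> real" where
  "sphere_laplacian f = sphere_divergence (sphere_gradient f)"

text \<open>A check of the normalisation: linear functions restrict to the spherical harmonics of
  degree 1, with eigenvalue \<open>-2\<close>.\<close>

lemma sphere_laplacian_inner: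
  fixes a x :: "real^3"
  assumes x: "norm x = 1"
  shows "sphere_laplacian (\<lambda>y. y \<bullet> a) x = - 2 * (x \<bullet> a)"
proof -
  have grad: "sphere_partial i (\<lambda>y. y \<bullet> a) y = a $ i - (y \<bullet> a) * y $ i" if y: "norm y = 1"
    for i y
  proof -
    have "y \<noteq> 0" using y by auto
    have "((\<lambda>z. (z \<bullet> a) / norm z) has_derivative
        (\<lambda>h. h \<bullet> a - (y \<bullet> a) * (h \<bullet> y))) (at y)"
      using y \<open>y \<noteq> 0\<close>
      by (auto intro!: derivative_eq_intros has_derivative_norm simp: sgn_div_norm inner_commute)
    moreover have "(\<lambda>y. y \<bullet> a) \<circ> sgn = (\<lambda>z. (z \<bullet> a) / norm z)"
      by (auto simp: sgn_div_norm divide_simps fun_eq_iff)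
    ultimately show ?thesis
      by (simp add: sphere_partial_def inner_axis' frechet_derivative_at[symmetric])
  qed
  have div: "sphere_partial i (\<lambda>y. sphere_gradient (\<lambda>y. y \<bullet> a) y $ i) x =
      2 * (x \<bullet> a) * (x $ i)\<^sup>2 - a $ i * x $ i - x \<bullet> a" for i
  proof -
    let ?g = "\<lambda>z. a $ i - (z \<bullet> a) * (z $ i) / (z \<bullet> z)"
    have "x \<noteq> 0" and xx: "x \<bullet> x = 1" using x by (auto simp: dot_square_norm)
    have "(?g has_derivative
        (\<lambda>h. 2 * (x \<bullet> a) * x $ i * (h \<bullet> x) - (h \<bullet> a) * x $ i - (x \<bullet> a) * h $ i)) (at x)"
      using xx \<open>x \<noteq> 0\<close>
      by (auto intro!: derivative_eq_intros bounded_linear.has_derivative[OF bounded_linear_vec_nth]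
          simp: inner_commute algebra_simps)
    then have "(((\<lambda>y. sphere_gradient (\<lambda>y. y \<bullet> a) y $ i) \<circ> sgn) has_derivative
        (\<lambda>h. 2 * (x \<bullet> a) * x $ i * (h \<bullet> x) - (h \<bullet> a) * x $ i - (x \<bullet> a) * h $ i)) (at x)"
    proof (rule has_derivative_transform_within_open)
      show "open (- {0 :: real^3})" "x \<in> - {0}" using \<open>x \<noteq> 0\<close> by auto
      fix z :: "real^3" assume z: "z \<in> - {0}"
      have "norm (sgn z) = 1" using z by (simp add: norm_sgn)
      from grad[OF this] show "?g z = ((\<lambda>y. sphere_gradient (\<lambda>y. y \<bullet> a) y $ i) \<circ> sgn) z"
        using z
        by (simp add: sphere_gradient_def sgn_div_norm dot_square_norm power2_eq_square divide_simps)
    qed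
    then show ?thesis
      by (simp add: sphere_partial_def frechet_derivative_at[symmetric] inner_axis' power2_eq_square)
  qed
  have "(\<Sum>i\<in>UNIV. (x $ i)\<^sup>2) = 1" "(\<Sum>i\<in>UNIV. a $ i * x $ i) = x \<bullet> a"
    using x by (auto simp: inner_vec_def norm_vec_def L2_set_def mult.commute)
  then show ?thesis
    by (simp add: sphere_laplacian_def sphere_divergence_def div sum_subtractf
        sum_distrib_left[symmetric])
qed

definition polar_angle :: "real^3 \<Rightarrow> real" where
  "polar_angle x = arccos (x $ 3)"

definition smooth_positive :: "real \<Rightarrow> (real^3 \<Rightarrow> real \<Rightarrow> real) \<Rightarrow> bool" where
  "smooth_positive T \<phi> \<longleftrightarrow>
     (\<forall>x\<in>sphere 0 1. \<forall>\<alpha>. \<phi> x (\<alpha> + T) = \<phi> x \<alpha>) \<and>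
     smooth_on (\<lambda>(x, \<alpha>). \<phi> x \<alpha>) (sphere 0 1 \<times> UNIV) \<and>
     (\<forall>x\<in>sphere 0 1. \<forall>\<alpha>. \<phi> x \<alpha> > 0)"

definition lichnerowicz :: "real \<Rightarrow> (real^3 \<Rightarrow> real \<Rightarrow> real) \<Rightarrow> bool" where
  "lichnerowicz b \<phi> \<longleftrightarrow>
     (\<forall>x\<in>sphere 0 1. \<forall>\<alpha>.
        - (deriv ^^ 2) (\<phi> x) \<alpha>
        - (sphere_laplacian (\<lambda>y. \<phi> y \<alpha>) x - 1/4 * \<phi> x \<alpha>)
        - 1/4 * \<phi> x \<alpha> ^ 5
        - b\<^sup>2 * (sin (polar_angle x))\<^sup>2 / \<phi> x \<alpha> ^ 7 = 0)"

end

theory Submission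
  imports Defs
begin

text \<open>
  Nonexistence: pointwise minimisation over \<open>f > 0\<close> bounds \<open>f^5/4 + b^2 (sin \<theta>)^2/f^7 - f/4\<close> from below
  by a function of \<open>\<theta>\<close> alone, and for \<open>\<bar>b\<bar> \<ge> 0.2475\<close> this function has positive mean over the
  sphere. Hence there is an explicit polynomial \<open>\<psi>\<close> in \<open>cos \<theta>\<close> whose negative Laplacian is strictly
  smaller than it. At a minimum of \<open>\<phi> - \<psi>\<close> the second derivatives contradict the equation.

  Existence: both hypotheses give \<open>b^2 \<le> 0.00586\<close>, and then there is a solution near the solution \<open>1\<close>
  for \<open>b = 0\<close> that depends on \<open>\<theta>\<close> only. With \<open>\<phi> = 1 + v (cos \<theta>)\<close>, \<open>v\<close> a power series, the equation is
  \<open>- \<Delta> v - v = (10 v^2 + 10 v^3 + 5 v^4 + v^5)/4 + b^2 (sin \<theta>)^2 (1 + v)^(-7)\<close>.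
  The operator on the left has an inverse of norm at most 1 on the power series with weighted
  \<open>l^1\<close> norm of weight \<open>r \<ge> 1\<close>. This space is a Banach algebra, so the contraction principle applies, and
  \<open>r > 1\<close> makes the solution analytic across the poles.
\<close>

subsection \<open>The spherical Laplacian\<close>

text \<open>If \<open>c\<close> were negative, \<open>p'\<close> would be negative just to the right
  of \<open>a\<close>, and the mean value theorem would put \<open>p\<close> below its minimum. A
  second derivative is required only at \<open>a\<close>, matching
  \<open>sphere_twice_diff\<close>.\<close>

lemma second_derivative_test:
  fixes p :: "real \<Rightarrow> real"
  assumes p: "\<forall>\<^sub>F t in nhds a. (p has_real_derivative p' t) (at t)"
    and p': "(p' has_real_derivative c) (at a)"
    and min: "\<forall>\<^sub>F t in nhds a. p a \<le> p t"
  shows "p' a = 0" "c \<ge> 0"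
proof -
  obtain d1 where d1: "d1 > 0" "\<And>t. \<bar>t - a\<bar> < d1 \<Longrightarrow> (p has_real_derivative p' t) (at t)"
    using p by (auto simp: eventually_nhds_metric dist_real_def)
  obtain d2 where d2: "d2 > 0" "\<And>t. \<bar>t - a\<bar> < d2 \<Longrightarrow> p a \<le> p t"
    using min by (auto simp: eventually_nhds_metric dist_real_def)
  show p'a: "p' a = 0"
    using DERIV_local_min[of p "p' a" a d2] d1 d2 by (auto simp: abs_minus_commute)
  show "c \<ge> 0"
  proof (rule ccontr)
    assume "\<not> c \<ge> 0"
    then obtain d3 where d3: "d3 > 0" "\<And>h. 0 < h \<Longrightarrow> h < d3 \<Longrightarrow> p' (a + h) < p' a"
      using has_real_derivative_neg_dec_right[OF p'] by auto
    define d where "d = min d1 (min d2 d3) / 2"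
    have d: "d > 0" "d < d1" "d < d2" "d < d3" using d1 d2 d3 by (auto simp: d_def)
    have "\<exists>z>a. z < a + d \<and> p (a + d) - p a = (a + d - a) * p' z"
      using d d1 by (intro MVT2) auto
    then obtain z where z: "a < z" "z < a + d" "p (a + d) - p a = d * p' z" by auto
    have "p' z < 0" using d3(2)[of "z - a"] z d p'a by auto
    then have "p (a + d) < p a" using z d by (simp add: mult_pos_neg algebra_simps)
    with d2(2)[of "a + d"] d show False by auto
  qed
qed

lemma has_derivative_sgn:
  fixes y :: "'a::real_inner"
  assumes "y \<noteq> 0"
  shows "(sgn has_derivative (\<lambda>h. h /\<^sub>R norm y - ((y \<bullet> h) / norm y ^ 3) *\<^sub>R y)) (at y)"
proof -
  have "((\<lambda>y. y /\<^sub>R norm y) has_derivative (\<lambda>h. h /\<^sub>R norm y - ((y \<bullet> h) / norm y ^ 3) *\<^sub>R y)) (at y)"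
    using assms
    by (auto intro!: derivative_eq_intros has_derivative_norm
        simp: sgn_div_norm power3_eq_cube divide_simps inner_commute fun_eq_iff)
  moreover have "sgn = (\<lambda>y::'a. y /\<^sub>R norm y)" by (auto simp: sgn_div_norm fun_eq_iff)
  ultimately show ?thesis by simp
qed

text \<open>\<open>frechet_derivative\<close> is unspecified where no derivative exists. This is the
  regularity that makes \<open>sphere_laplacian\<close> meaningful: the extension constant along
  rays has first derivatives near \<open>x\<close> and second derivatives at
  \<open>x\<close>.\<close>

definition sphere_twice_diff :: "(real^3 \<Rightarrow> real) \<Rightarrow> real^3 \<Rightarrow> bool" where
  "sphere_twice_diff u x \<longleftrightarrow> (\<forall>\<^sub>F y in nhds x. (u \<circ> sgn) differentiable (at y)) \<and>
     (\<forall>i. sphere_partial i u differentiable (at x))"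

lemma sphere_partial_eq:
  "((u \<circ> sgn) has_derivative D) (at y) \<Longrightarrow> sphere_partial i u y = D (axis i 1)"
  by (simp add: sphere_partial_def frechet_derivative_at[symmetric])

lemma sphere_partial_has_derivative:
  "(u \<circ> sgn) differentiable (at y) \<Longrightarrow>
    ((u \<circ> sgn) has_derivative frechet_derivative (u \<circ> sgn) (at y)) (at y)"
  by (simp add: frechet_derivative_works)

text \<open>The extension \<open>u \<circ> sgn\<close> is homogeneous of degree 0, so its partial
  derivatives are homogeneous of degree -1: precomposing with the scaling by
  \<open>1 / norm y\<close> does not change it, and the chain rule compares the two
  derivatives.\<close>

lemma sphere_partial_sgn:
  assumes y: "y \<noteq> 0" and d: "(u \<circ> sgn) differentiable (at (sgn y))"
  shows "sphere_partial i u (sgn y) = norm y * sphere_partial i u y"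
proof -
  let ?D = "frechet_derivative (u \<circ> sgn) (at (sgn y))"
  have D: "((u \<circ> sgn) has_derivative ?D) (at (sgn y))"
    using d by (simp add: frechet_derivative_works)
  have "((\<lambda>z. z /\<^sub>R norm y) has_derivative (\<lambda>h. h /\<^sub>R norm y)) (at y)"
    by (auto intro!: derivative_eq_intros)
  moreover have "sgn y = y /\<^sub>R norm y" by (simp add: sgn_div_norm)
  ultimately have "((u \<circ> sgn) \<circ> (\<lambda>z. z /\<^sub>R norm y) has_derivative ?D \<circ> (\<lambda>h. h /\<^sub>R norm y)) (at y)"
    using D by (intro diff_chain_at) simp_all
  moreover have "(u \<circ> sgn) \<circ> (\<lambda>z. z /\<^sub>R norm y) = u \<circ> sgn"
    using y by (auto simp: fun_eq_iff sgn_scaleR)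
  ultimately have "sphere_partial i u y = ?D (axis i 1 /\<^sub>R norm y)"
    using sphere_partial_eq by fastforce
  also have "\<dots> = ?D (axis i 1) /\<^sub>R norm y"
    using D has_derivative_linear linear_scale by blast
  finally show ?thesis using y by (simp add: sphere_partial_def)
qed

text \<open>The divergence composes the partial derivatives with \<open>sgn\<close> again. By
  homogeneity of degree -1 this amounts to multiplying them by the norm, and the product rule adds
  the terms \<open>x $ i * sphere_partial i u x\<close>.\<close>

lemma sphere_laplacian_eq:
  assumes x: "norm x = 1" and u: "sphere_twice_diff u x"
  shows "sphere_laplacian u x = (\<Sum>i\<in>UNIV. x $ i * sphere_partial i u x +
           frechet_derivative (sphere_partial i u) (at x) (axis i 1))"
proof -
  have sx: "sgn x = x" and x0: "x \<noteq> 0" using x by (auto simp: sgn_div_norm)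
  have "isCont sgn x" using x0 by (intro continuous_sgn) auto
  then have "filterlim sgn (nhds x) (nhds x)"
    using sx tendsto_at_iff_tendsto_nhds[of sgn x] by (simp add: isCont_def)
  moreover have ev: "\<forall>\<^sub>F y in nhds x. (u \<circ> sgn) differentiable (at y)"
    using u by (simp add: sphere_twice_diff_def)
  ultimately have "\<forall>\<^sub>F y in nhds x. (u \<circ> sgn) differentiable (at (sgn y))"
    using eventually_compose_filterlim by blast
  moreover have "\<forall>\<^sub>F y in nhds x. y \<noteq> 0" using x0 by (simp add: t1_space_nhds)
  ultimately have hom: "\<forall>\<^sub>F y in nhds x. norm y * sphere_partial i u y = (sphere_partial i u \<circ> sgn) y" for i
    by eventually_elim (simp add: sphere_partial_sgn)
  have "sphere_partial i (\<lambda>y. sphere_gradient u y $ i) x =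
      x $ i * sphere_partial i u x + frechet_derivative (sphere_partial i u) (at x) (axis i 1)" for i
  proof -
    let ?D = "frechet_derivative (sphere_partial i u) (at x)"
    have D: "(sphere_partial i u has_derivative ?D) (at x)"
      using u by (simp add: sphere_twice_diff_def frechet_derivative_works)
    have "((\<lambda>y. norm y * sphere_partial i u y) has_derivative
        (\<lambda>h. norm x * ?D h + (h \<bullet> sgn x) * sphere_partial i u x)) (at x)"
      using x0 by (auto intro!: has_derivative_mult has_derivative_norm D)
    then have "((sphere_partial i u \<circ> sgn) has_derivative
        (\<lambda>h. norm x * ?D h + (h \<bullet> sgn x) * sphere_partial i u x)) (at x)"
      by (rule has_derivative_transform_eventually)
        (use hom[of i] x sx in \<open>auto simp: eventually_nhds_conv_at\<close>)
    then show ?thesis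
      using x sx by (simp add: sphere_gradient_def sphere_partial_eq inner_axis' comp_def)
  qed
  then show ?thesis by (simp add: sphere_laplacian_def sphere_divergence_def)
qed

text \<open>Needed on a neighbourhood and not just at \<open>x\<close>, because the identity is
  differentiated once more.\<close>

lemma eventually_sphere_partial_diff:
  assumes "sphere_twice_diff u x" "sphere_twice_diff v x"
  shows "\<forall>\<^sub>F y in nhds x. sphere_partial i u y - sphere_partial i v y = sphere_partial i (\<lambda>y. u y - v y) y"
proof -
  have "\<forall>\<^sub>F y in nhds x. (u \<circ> sgn) differentiable (at y)" "\<forall>\<^sub>F y in nhds x. (v \<circ> sgn) differentiable (at y)"
    using assms by (auto simp: sphere_twice_diff_def)
  then show ?thesis
  proof eventually_elim
    case (elim y)
    have "((\<lambda>z. (u \<circ> sgn) z - (v \<circ> sgn) z) has_derivative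
       (\<lambda>h. frechet_derivative (u \<circ> sgn) (at y) h - frechet_derivative (v \<circ> sgn) (at y) h)) (at y)"
      using elim[unfolded frechet_derivative_works] by (rule has_derivative_diff)
    moreover have "(\<lambda>z. (u \<circ> sgn) z - (v \<circ> sgn) z) = (\<lambda>y. u y - v y) \<circ> sgn"
      by (simp add: comp_def)
    ultimately show ?case
      by (simp only: sphere_partial_eq) (simp add: sphere_partial_def)
  qed
qed

lemma sphere_partial_diff_has_derivative:
  assumes "sphere_twice_diff u x" "sphere_twice_diff v x"
  shows "(sphere_partial i (\<lambda>y. u y - v y) has_derivative
     (\<lambda>h. frechet_derivative (sphere_partial i u) (at x) h - frechet_derivative (sphere_partial i v) (at x) h)) (at x)"
proof (rule has_derivative_transform_eventually)
  show "((\<lambda>y. sphere_partial i u y - sphere_partial i v y) has_derivative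
     (\<lambda>h. frechet_derivative (sphere_partial i u) (at x) h - frechet_derivative (sphere_partial i v) (at x) h)) (at x)"
    using assms by (intro has_derivative_diff) (auto simp: sphere_twice_diff_def frechet_derivative_works)
qed (use eventually_sphere_partial_diff[OF assms, of i] in \<open>auto simp: eventually_nhds_conv_at\<close>)

lemma sphere_twice_diff_diff:
  assumes "sphere_twice_diff u x" "sphere_twice_diff v x"
  shows "sphere_twice_diff (\<lambda>y. u y - v y) x"
proof -
  have "\<forall>\<^sub>F y in nhds x. (u \<circ> sgn) differentiable (at y)" "\<forall>\<^sub>F y in nhds x. (v \<circ> sgn) differentiable (at y)"
    using assms by (auto simp: sphere_twice_diff_def)
  then have "\<forall>\<^sub>F y in nhds x. ((\<lambda>y. u y - v y) \<circ> sgn) differentiable (at y)"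
    by eventually_elim (auto simp: comp_def)
  then show ?thesis
    using sphere_partial_diff_has_derivative[OF assms]
    by (auto simp: sphere_twice_diff_def intro: differentiableI)
qed

lemma sphere_laplacian_diff:
  assumes "norm x = 1" "sphere_twice_diff u x" "sphere_twice_diff v x"
  shows "sphere_laplacian (\<lambda>y. u y - v y) x = sphere_laplacian u x - sphere_laplacian v x"
proof -
  have "sphere_partial i (\<lambda>y. u y - v y) x = sphere_partial i u x - sphere_partial i v x" for i
    using eventually_nhds_x_imp_x[OF eventually_sphere_partial_diff[OF assms(2,3)]] by simp
  moreover have "frechet_derivative (sphere_partial i (\<lambda>y. u y - v y)) (at x) h =
      frechet_derivative (sphere_partial i u) (at x) h - frechet_derivative (sphere_partial i v) (at x) h" for i h
    using frechet_derivative_at[OF sphere_partial_diff_has_derivative[OF assms(2,3)]] by metis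
  ultimately show ?thesis
    using assms by (simp add: sphere_laplacian_eq sphere_twice_diff_diff sum.distrib sum_subtractf right_diff_distrib)
qed

text \<open>The extension \<open>u \<circ> sgn\<close> takes only values of \<open>u\<close> on the
  sphere, so along each coordinate line through \<open>x\<close> it has a local minimum at
  \<open>x\<close>. The second derivative test on these lines makes every summand of
  \<open>sphere_laplacian_eq\<close> nonnegative.\<close>

lemma sphere_laplacian_nonneg_at_min:
  assumes x: "norm x = 1" and u: "sphere_twice_diff u x"
    and min: "\<And>y. norm y = 1 \<Longrightarrow> u x \<le> u y"
  shows "sphere_laplacian u x \<ge> 0"
proof -
  have sx: "sgn x = x" and x0: "x \<noteq> 0" using x by (auto simp: sgn_div_norm)
  have "sphere_partial i u x = 0 \<and> frechet_derivative (sphere_partial i u) (at x) (axis i 1) \<ge> 0" for i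
  proof -
    define L :: "real \<Rightarrow> real^3" where "L = (\<lambda>t. x + t *\<^sub>R axis i 1)"
    have L: "(L has_derivative (\<lambda>t. t *\<^sub>R axis i 1)) (at t)" for t
      unfolding L_def by (auto intro!: derivative_eq_intros)
    have L0: "L 0 = x" by (simp add: L_def)
    have "isCont L 0" using L has_derivative_continuous by blast
    then have Llim: "filterlim L (nhds x) (nhds 0)"
      using L0 tendsto_at_iff_tendsto_nhds[of L 0] by (simp add: isCont_def)
    have along: "((f \<circ> L) has_real_derivative D (axis i 1)) (at t)"
      if "(f has_derivative D) (at (L t))" for f D t
    proof -
      have "((f \<circ> L) has_derivative D \<circ> (\<lambda>t. t *\<^sub>R axis i 1)) (at t)"
        by (rule diff_chain_at[OF L that])
      moreover have "D \<circ> (\<lambda>t. t *\<^sub>R axis i 1) = (\<lambda>t. t * D (axis i 1))"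
        using that by (auto simp: fun_eq_iff linear_scale[OF has_derivative_linear])
      ultimately show ?thesis by (simp add: has_field_derivative_def mult.commute[of _ "D _"])
    qed
    have "\<forall>\<^sub>F y in nhds x. (u \<circ> sgn) differentiable (at y)"
      using u by (simp add: sphere_twice_diff_def)
    then have "\<forall>\<^sub>F t in nhds 0. (u \<circ> sgn) differentiable (at (L t))"
      using Llim eventually_compose_filterlim by blast
    then have p: "\<forall>\<^sub>F t in nhds 0. (((u \<circ> sgn) \<circ> L) has_real_derivative (sphere_partial i u \<circ> L) t) (at t)"
      by eventually_elim (simp add: sphere_partial_def along[OF sphere_partial_has_derivative])
    have p': "((sphere_partial i u \<circ> L) has_real_derivative
        frechet_derivative (sphere_partial i u) (at x) (axis i 1)) (at 0)"
      using u L0 by (intro along) (simp add: sphere_twice_diff_def frechet_derivative_works)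
    have "\<forall>\<^sub>F y in nhds x. y \<noteq> 0" using x0 by (simp add: t1_space_nhds)
    then have "\<forall>\<^sub>F t in nhds 0. L t \<noteq> 0"
      using Llim eventually_compose_filterlim by blast
    then have m: "\<forall>\<^sub>F t in nhds 0. ((u \<circ> sgn) \<circ> L) 0 \<le> ((u \<circ> sgn) \<circ> L) t"
      by eventually_elim (simp add: L0 sx min norm_sgn)
    show ?thesis using second_derivative_test[OF p p' m] by (simp add: L0)
  qed
  then show ?thesis
    unfolding sphere_laplacian_eq[OF x u] by (intro sum_nonneg) simp
qed

text \<open>Near \<open>x\<close> the functions \<open>u \<circ> sgn\<close> and
  \<open>F \<circ> sgn\<close> coincide, so the chain rule transfers the regularity of any local
  extension \<open>F\<close> to the extension constant along rays.\<close>

lemma sphere_twice_diff_extension: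
  assumes x: "norm x = 1" and U: "open U" "x \<in> U"
    and F: "\<And>y. y \<in> U \<Longrightarrow> F differentiable (at y)"
    and F': "\<And>j. (\<lambda>y. frechet_derivative F (at y) (axis j 1)) differentiable (at x)"
    and eq: "\<And>y. norm y = 1 \<Longrightarrow> y \<in> U \<Longrightarrow> F y = u y"
  shows "sphere_twice_diff u x"
proof -
  have sx: "sgn x = x" and x0: "x \<noteq> 0" using x by (auto simp: sgn_div_norm)
  define W where "W = {y. y \<noteq> 0 \<and> sgn y \<in> U}"
  have "open (- {0} \<inter> sgn -` U)"
    by (rule continuous_open_preimage) (use U in \<open>auto intro!: continuous_at_imp_continuous_on continuous_sgn\<close>)
  then have W: "open W" "x \<in> W" using x0 sx U by (auto simp: W_def vimage_def Int_def Compl_eq conj_commute)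
  \<comment> \<open>\<open>D y\<close> is the derivative of \<open>sgn\<close> at
    \<open>y\<close>.\<close>
  define D where "D = (\<lambda>y h::real^3. h /\<^sub>R norm y - ((y \<bullet> h) / norm y ^ 3) *\<^sub>R y)"
  have h: "((u \<circ> sgn) has_derivative (\<lambda>h. frechet_derivative F (at (sgn y)) (D y h))) (at y)" if "y \<in> W" for y
  proof (rule has_derivative_transform_within_open)
    have "((F \<circ> sgn) has_derivative (frechet_derivative F (at (sgn y)) \<circ> D y)) (at y)"
      using that F unfolding D_def
      by (intro diff_chain_at has_derivative_sgn) (auto simp: W_def frechet_derivative_works)
    then show "((F \<circ> sgn) has_derivative (\<lambda>h. frechet_derivative F (at (sgn y)) (D y h))) (at y)"
      by (simp add: comp_def)
    show "open W" "y \<in> W" using W that by auto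
    show "(F \<circ> sgn) z = (u \<circ> sgn) z" if "z \<in> W" for z
      using that eq by (simp add: W_def norm_sgn)
  qed
  have part: "sphere_partial i u y = (\<Sum>j\<in>UNIV. (D y (axis i 1)) $ j * frechet_derivative F (at (sgn y)) (axis j 1))"
    if "y \<in> W" for i y
  proof -
    have lin: "linear (frechet_derivative F (at (sgn y)))"
      using that F by (simp add: W_def linear_frechet_derivative)
    have "sphere_partial i u y = frechet_derivative F (at (sgn y)) (D y (axis i 1))"
      using sphere_partial_eq[OF h[OF that]] by simp
    \<comment> \<open>The direction \<open>D y (axis i 1)\<close> varies with \<open>y\<close>.
      Expanding it in the standard basis leaves derivatives of \<open>F\<close> in fixed directions,
      which \<open>F'\<close> covers.\<close>
    also have "D y (axis i 1) = (\<Sum>j\<in>UNIV. (D y (axis i 1)) $ j *\<^sub>R axis j 1)"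
      using basis_expansion[of "D y (axis i 1)"] by (simp add: scalar_mult_eq_scaleR)
    finally show ?thesis
      by (simp add: linear_sum[OF lin] linear_scale[OF lin] comp_def)
  qed
  have dsgn: "sgn differentiable (at x)" using has_derivative_sgn[OF x0] by (auto simp: differentiable_def)
  have "sphere_partial i u differentiable (at x)" for i
  proof -
    have "(\<lambda>y. frechet_derivative F (at (sgn y)) (axis j 1)) differentiable (at x)" for j
      using differentiable_chain_at[of sgn x "\<lambda>y. frechet_derivative F (at y) (axis j 1)"] dsgn F' sx
      by (simp add: comp_def)
    moreover have "(\<lambda>y. (D y (axis i 1)) $ j) differentiable (at x)" for j
    proof -
      have "(\<lambda>y::real^3. y $ j) differentiable (at x)" "(\<lambda>y::real^3. y \<bullet> axis i 1) differentiable (at x)"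
        by (auto intro!: bounded_linear_imp_differentiable bounded_linear_vec_nth bounded_linear_inner_left)
      moreover have "(\<lambda>y. inverse (norm y)) differentiable (at x)"
        using x0 by (auto intro!: differentiable_inverse differentiable_norm_at)
      ultimately have "(\<lambda>y. inverse (norm y) * axis i 1 $ j -
          (y \<bullet> axis i 1) * inverse (norm y) ^ 3 * y $ j) differentiable (at x)"
        by (intro differentiable_diff differentiable_mult differentiable_power differentiable_const)
      then show ?thesis by (simp add: D_def divide_inverse power_inverse)
    qed
    ultimately have "(\<lambda>y. \<Sum>j\<in>UNIV. (D y (axis i 1)) $ j * frechet_derivative F (at (sgn y)) (axis j 1)) differentiable (at x)"
      by (intro differentiable_sum) (auto intro!: differentiable_mult)
    then obtain E where "((\<lambda>y. \<Sum>j\<in>UNIV. (D y (axis i 1)) $ j * frechet_derivative F (at (sgn y)) (axis j 1)) has_derivative E) (at x)"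
      by (auto simp: differentiable_def)
    then have "(sphere_partial i u has_derivative E) (at x)"
      by (rule has_derivative_transform_within_open[OF _ W]) (simp add: part)
    then show ?thesis by (auto simp: differentiable_def)
  qed
  moreover have "\<forall>\<^sub>F y in nhds x. (u \<circ> sgn) differentiable (at y)"
    using h W by (auto simp: eventually_nhds differentiable_def)
  ultimately show ?thesis by (simp add: sphere_twice_diff_def)
qed

text \<open>On functions of \<open>u = cos \<theta>\<close> the Laplacian is the Legendre operator.
  The proof differentiates \<open>g (y $ 3 / norm y)\<close> twice. The set \<open>V\<close> allows
  for power series that converge only on an interval.\<close>

lemma sphere_zonal:
  fixes x :: "real^3"
  assumes x: "norm x = 1" and V: "open V" "x $ 3 \<in> V"
    and g: "\<And>t. t \<in> V \<Longrightarrow> (g has_real_derivative g' t) (at t)"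
    and g': "(g' has_real_derivative g2) (at (x $ 3))"
  shows "sphere_twice_diff (\<lambda>y. g (y $ 3)) x"
    and "sphere_laplacian (\<lambda>y. g (y $ 3)) x = (1 - (x $ 3)\<^sup>2) * g2 - 2 * x $ 3 * g' (x $ 3)"
proof -
  have x0: "x \<noteq> 0" using x by auto
  define s where "s = (\<lambda>y::real^3. y $ 3 / norm y)"
  define W where "W = - {0} \<inter> s -` V"
  have "open W" unfolding W_def s_def
    by (rule continuous_open_preimage) (use V in \<open>auto intro!: continuous_intros\<close>)
  then have W: "open W" "x \<in> W" using x0 V x by (auto simp: W_def s_def)
  have s: "(s has_derivative (\<lambda>h. h $ 3 / norm y - y $ 3 * (y \<bullet> h) / norm y ^ 3)) (at y)" if "y \<in> W" for y
    unfolding s_def using that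
    by (auto intro!: derivative_eq_intros has_derivative_norm bounded_linear.has_derivative[OF bounded_linear_vec_nth]
        simp: W_def sgn_div_norm power3_eq_cube divide_simps inner_commute fun_eq_iff)
  have comp: "(\<lambda>y. g (y $ 3)) \<circ> sgn = g \<circ> s"
    by (auto simp: fun_eq_iff s_def sgn_div_norm divide_inverse_commute)
  have h: "((\<lambda>y. g (y $ 3)) \<circ> sgn has_derivative
      (\<lambda>h. g' (s y) * (h $ 3 / norm y - y $ 3 * (y \<bullet> h) / norm y ^ 3))) (at y)" if "y \<in> W" for y
  proof -
    have "(g has_derivative (*) (g' (s y))) (at (s y))"
      using g[of "s y"] that by (simp add: has_field_derivative_def W_def)
    from diff_chain_at[OF s[OF that] this] show ?thesis
      unfolding comp by (simp add: comp_def)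
  qed
  define P where "P = (\<lambda>i y. g' (s y) * (axis i 1 $ 3 / norm y - y $ 3 * (y $ i) / norm y ^ 3))"
  have part: "sphere_partial i (\<lambda>y. g (y $ 3)) y = P i y" if "y \<in> W" for i y
    using sphere_partial_eq[OF h[OF that], of i] by (simp add: P_def inner_axis)
  have P: "(P i has_derivative (\<lambda>h. g2 * (h $ 3 - x $ 3 * (x \<bullet> h)) * (axis i 1 $ 3 - x $ 3 * x $ i) +
      g' (x $ 3) * (- axis i 1 $ 3 * (x \<bullet> h) - h $ 3 * x $ i - x $ 3 * h $ i + 3 * x $ 3 * x $ i * (x \<bullet> h)))) (at x)"
    for i
  proof -
    have sx: "s x = x $ 3" using x by (simp add: s_def)
    have "(g' has_derivative (*) g2) (at (s x))"
      using g' sx by (simp add: has_field_derivative_def)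
    from diff_chain_at[OF s[OF W(2)] this]
    have "((\<lambda>y. g' (s y)) has_derivative (\<lambda>h. g2 * (h $ 3 - x $ 3 * (x \<bullet> h)))) (at x)"
      using x by (simp add: comp_def)
    moreover have "((\<lambda>y. axis i 1 $ 3 / norm y - y $ 3 * (y $ i) / norm y ^ 3) has_derivative
        (\<lambda>h. - axis i 1 $ 3 * (x \<bullet> h) - h $ 3 * x $ i - x $ 3 * h $ i + 3 * x $ 3 * x $ i * (x \<bullet> h))) (at x)"
      using x x0
      by (auto intro!: derivative_eq_intros has_derivative_norm bounded_linear.has_derivative[OF bounded_linear_vec_nth]
          simp: sgn_div_norm inner_commute fun_eq_iff algebra_simps)
    ultimately show ?thesis
      unfolding P_def
      by (rule has_derivative_eq_rhs[OF has_derivative_mult]) (use x sx in \<open>auto simp: algebra_simps\<close>)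
  qed
  have P2: "(sphere_partial i (\<lambda>y. g (y $ 3)) has_derivative (\<lambda>h. g2 * (h $ 3 - x $ 3 * (x \<bullet> h)) * (axis i 1 $ 3 - x $ 3 * x $ i) +
      g' (x $ 3) * (- axis i 1 $ 3 * (x \<bullet> h) - h $ 3 * x $ i - x $ 3 * h $ i + 3 * x $ 3 * x $ i * (x \<bullet> h)))) (at x)"
    for i
    by (rule has_derivative_transform_within_open[OF P W]) (simp add: part)
  show td: "sphere_twice_diff (\<lambda>y. g (y $ 3)) x"
    using h W P2 unfolding sphere_twice_diff_def eventually_nhds differentiable_def by blast
  have n: "(x $ 1)\<^sup>2 + (x $ 2)\<^sup>2 + (x $ 3)\<^sup>2 = 1"
    using x by (simp add: norm_eq_1 inner_vec_def sum_3 power2_eq_square)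
  have ax: "axis i (1::real) $ (j::3) = (if j = i then 1 else 0)" for i j
    by (simp add: axis_def)
  have "sphere_laplacian (\<lambda>y. g (y $ 3)) x =
     g2 * (((x $ 1)\<^sup>2 + (x $ 2)\<^sup>2) * (x $ 3)\<^sup>2 + (1 - (x $ 3)\<^sup>2)\<^sup>2) +
     g' (x $ 3) * (- 4 * x $ 3 + 2 * x $ 3 * ((x $ 1)\<^sup>2 + (x $ 2)\<^sup>2 + (x $ 3)\<^sup>2))"
    unfolding sphere_laplacian_eq[OF x td] frechet_derivative_at[OF P2, symmetric] part[OF W(2)]
    using x by (simp add: sum_3 P_def s_def ax inner_axis power2_eq_square algebra_simps)
  also have "(x $ 1)\<^sup>2 + (x $ 2)\<^sup>2 = 1 - (x $ 3)\<^sup>2" using n by simp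
  also have "g2 * ((1 - (x $ 3)\<^sup>2) * (x $ 3)\<^sup>2 + (1 - (x $ 3)\<^sup>2)\<^sup>2) +
     g' (x $ 3) * (- 4 * x $ 3 + 2 * x $ 3 * (1 - (x $ 3)\<^sup>2 + (x $ 3)\<^sup>2)) =
     (1 - (x $ 3)\<^sup>2) * g2 - 2 * x $ 3 * g' (x $ 3)"
    by (simp add: power2_eq_square algebra_simps)
  finally show "sphere_laplacian (\<lambda>y. g (y $ 3)) x = (1 - (x $ 3)\<^sup>2) * g2 - 2 * x $ 3 * g' (x $ 3)" .
qed

subsection \<open>The barrier\<close>

text \<open>The tangent at \<open>g\<close> to a convex function; the factor
  \<open>(f - g)\<^sup>2\<close> of the difference shows the double contact.\<close>

lemma fifth_power_tangent:
  fixes f g :: real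
  assumes "f > 0" "g > 0"
  shows "f ^ 5 \<ge> 5 * g ^ 4 * f - 4 * g ^ 5"
proof -
  have "f ^ 5 - (5 * g ^ 4 * f - 4 * g ^ 5) = (f - g)\<^sup>2 * (f ^ 3 + 2 * f\<^sup>2 * g + 3 * f * g\<^sup>2 + 4 * g ^ 3)"
    by algebra
  also have "\<dots> \<ge> 0" using assms by simp
  finally show ?thesis by simp
qed

text \<open>Again a tangent to a convex function: at \<open>f = g\<close> the left side has value
  \<open>g\<close> and slope -7.\<close>

lemma inverse_seventh_power_tangent:
  fixes f g :: real
  assumes "f > 0" "g > 0"
  shows "g ^ 8 / f ^ 7 \<ge> 8 * g - 7 * f"
proof -
  have "g ^ 8 - (8 * g - 7 * f) * f ^ 7 = (f - g)\<^sup>2 * (g ^ 6 + 2 * g ^ 5 * f + 3 * g ^ 4 * f\<^sup>2 +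
      4 * g ^ 3 * f ^ 3 + 5 * g\<^sup>2 * f ^ 4 + 6 * g * f ^ 5 + 7 * f ^ 6)"
    by algebra
  also have "\<dots> \<ge> 0" using assms by simp
  finally show ?thesis using assms by (simp add: pos_le_divide_eq)
qed

text \<open>The value \<open>g^8 (5 g^4 - 1) / 28\<close> of \<open>B\<close> is the one for which
  \<open>f^5/4 + B/f^7 - f/4\<close>, as a function of \<open>f\<close>, has its minimum at \<open>g\<close>.\<close>
lemma source_lower_bound:
  fixes f g B :: real
  assumes "f > 0" "g > 0" "5 * g ^ 4 \<ge> 1" "B \<ge> g ^ 8 * (5 * g ^ 4 - 1) / 28"
  shows "f ^ 5 / 4 + B / f ^ 7 - f / 4 \<ge> (3 * g ^ 5 - 2 * g) / 7"
proof -
  have "(5 * g ^ 4 - 1) / 28 * (8 * g - 7 * f) \<le> (5 * g ^ 4 - 1) / 28 * (g ^ 8 / f ^ 7)"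
    using assms inverse_seventh_power_tangent[of f g] by (intro mult_left_mono) auto
  also have "\<dots> = (g ^ 8 * (5 * g ^ 4 - 1) / 28) / f ^ 7" by simp
  also have "\<dots> \<le> B / f ^ 7" using assms by (intro divide_right_mono) auto
  finally have "(5 * g ^ 4 - 1) / 28 * (8 * g - 7 * f) \<le> B / f ^ 7" .
  \<comment> \<open>The weight \<open>(5 * g ^ 4 - 1) / 28\<close> is chosen so that all terms
    linear in \<open>f\<close> cancel when the two tangent bounds are added.\<close>
  moreover have "(5 * g ^ 4 - 1) / 28 * (8 * g - 7 * f) =
      10 / 7 * g ^ 5 - 2 / 7 * g - 5 / 4 * (g ^ 4 * f) + f / 4"
    by (simp add: field_simps power_eq_if)
  moreover have "f ^ 5 \<ge> 5 * (g ^ 4 * f) - 4 * g ^ 5"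
    using fifth_power_tangent[OF assms(1,2)] by simp
  ultimately show ?thesis by (simp add: diff_divide_distrib)
qed

lemma source_lower_bound_pole:
  fixes f :: real
  assumes "f > 0"
  shows "f ^ 5 / 4 - f / 4 > - 0.1339"
proof -
  have "f ^ 5 \<ge> 5 * 0.6688 ^ 4 * f - 4 * 0.6688 ^ 5"
    using fifth_power_tangent[of f "0.6688"] assms by simp
  moreover have "(0.6688::real) ^ 4 > 1 / 5" "(0.6688::real) ^ 5 < 0.13385"
    by (simp_all add: power_eq_if)
  moreover have "f * 0.6688 ^ 4 \<ge> f * (1 / 5)" 
    using assms calculation(2) by (intro mult_left_mono) auto
  ultimately show ?thesis by (simp add: field_simps)
qed

text \<open>With \<open>y = (sin \<theta>)^2\<close>, this approximates the minimum over \<open>f\<close> of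
  \<open>f^5/4 + 0.2475^2 y/f^7 - f/4\<close> closely from below by a polynomial of mean zero over the sphere.
  The coefficients come from Hermite interpolation of that minimum, simply at \<open>y = 0\<close> and doubly
  at \<open>y = 0.415\<close> and \<open>y = 0.919\<close>, followed by rounding.\<close>
definition barrier_source :: "real \<Rightarrow> real" where
  "barrier_source y = - 0.1344 + 0.4384 * y - 0.6344 * y\<^sup>2 + 0.574 * y ^ 3 - 0.2016 * y ^ 4"

text \<open>This is concavity. The tangent minus \<open>barrier_source\<close> is
  \<open>(y - z)\<^sup>2\<close> times a quadratic polynomial, which is positive by completing
  squares.\<close>

lemma barrier_source_tangent:
  assumes "0 \<le> y" "y \<le> 1" "0 \<le> z" "z \<le> 1"
  shows "barrier_source y \<le>
    barrier_source z + (0.4384 - 1.2688 * z + 1.722 * z\<^sup>2 - 0.8064 * z ^ 3) * (y - z)"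
proof -
  \<comment> \<open>\<open>y + 2 * z\<close> is the quotient of \<open>y ^ 3\<close> minus its
    tangent at \<open>z\<close> by \<open>(y - z)\<^sup>2\<close>; for \<open>y ^ 4\<close> the
    quotient is \<open>y\<^sup>2 + 2 * y * z + 3 * z\<^sup>2\<close>.\<close>
  define s where "s = y + 2 * z"
  have s: "0.6344 - 0.574 * s + 0.2016 * (y\<^sup>2 + 2 * y * z + 3 * z\<^sup>2) \<ge> 0"
  proof -
    have "0.6344 - 0.574 * s + 0.2016 * (y\<^sup>2 + 2 * y * z + 3 * z\<^sup>2) =
       0.2016 * (2 / 3 * s\<^sup>2 + (y - z)\<^sup>2 / 3) - 0.574 * s + 0.6344"
      unfolding s_def by (simp add: field_simps power2_eq_square)
    also have "\<dots> = 0.1344 * (s - 0.287 / 0.1344)\<^sup>2 + 0.0672 * (y - z)\<^sup>2 + (0.6344 - 0.287\<^sup>2 / 0.1344)"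
      by (simp add: field_simps power2_eq_square)
    also have "\<dots> \<ge> 0" by (simp add: power2_eq_square)
    finally show ?thesis .
  qed
  have "barrier_source z + (0.4384 - 1.2688 * z + 1.722 * z\<^sup>2 - 0.8064 * z ^ 3) * (y - z) - barrier_source y
     = (y - z)\<^sup>2 * (0.6344 - 0.574 * s + 0.2016 * (y\<^sup>2 + 2 * y * z + 3 * z\<^sup>2))"
    unfolding barrier_source_def s_def by (simp add: field_simps power_eq_if)
  also have "\<dots> \<ge> 0" using s by simp
  finally show ?thesis by simp
qed

text \<open>For fixed \<open>f\<close> both sides are affine in \<open>y\<close>, so the strict
  inequality passes from the end points to the interval. Working with fixed \<open>f\<close> uses
  the concavity of the minimum over \<open>f\<close> without forming that minimum.\<close>

lemma chord_bound:
  fixes f :: real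
  assumes "f > 0" and "a < c" "a \<le> y" "y \<le> c"
    and "f ^ 5 / 4 + B * a / f ^ 7 - f / 4 > P + S * a"
    and "f ^ 5 / 4 + B * c / f ^ 7 - f / 4 > P + S * c"
  shows "f ^ 5 / 4 + B * y / f ^ 7 - f / 4 > P + S * y"
proof -
  define k d where "k = B / f ^ 7 - S" and "d = f ^ 5 / 4 - f / 4 - P"
  define h where "h = (\<lambda>t. k * t + d)"
  have "h a > 0" "h c > 0" using assms(5,6) by (simp_all add: h_def k_def d_def algebra_simps)
  moreover have "(c - a) * h y = (c - y) * h a + (y - a) * h c"
    by (simp add: h_def algebra_simps)
  moreover have "(c - y) * h a + (y - a) * h c > 0"
  proof (cases "y = c")
    case True then show ?thesis using assms \<open>h c > 0\<close> by simp
  next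
    case False then show ?thesis using assms \<open>h c > 0\<close> \<open>h a > 0\<close>
      by (intro add_pos_nonneg mult_pos_pos mult_nonneg_nonneg) auto
  qed
  ultimately have "h y > 0" using assms(2) by (metis diff_gt_0_iff_gt zero_less_mult_pos)
  then show ?thesis by (simp add: h_def k_def d_def algebra_simps)
qed

lemma barrier_source_less:
  fixes f y :: real
  assumes f: "f > 0" and y: "0 \<le> y" "y \<le> 1"
  shows "barrier_source y < f ^ 5 / 4 + 0.2475\<^sup>2 * y / f ^ 7 - f / 4"
proof -
  define F where "F = (\<lambda>y. f ^ 5 / 4 + 0.2475\<^sup>2 * y / f ^ 7 - f / 4)"
  \<comment> \<open>The minimum over \<open>f\<close> is concave in \<open>y\<close>, hence above its chords between the points of \<open>n0\<close>
    to \<open>n5\<close>; the concave \<open>barrier_source\<close> is below its tangent at \<open>z\<close>, and so below each chord.\<close>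
  have n0: "F 0 > - 0.1339"
    using source_lower_bound_pole[OF f] by (simp add: F_def)
  have n: "F a > m"
    if "g > 0" "5 * g ^ 4 \<ge> 1" "0.2475\<^sup>2 * a \<ge> g ^ 8 * (5 * g ^ 4 - 1) / 28" "(3 * g ^ 5 - 2 * g) / 7 > m"
    for a g m
    using source_lower_bound[OF f that(1-3)] that(4) by (simp add: F_def)
  \<comment> \<open>Each \<open>g\<close> is, up to rounding, the minimiser of \<open>F a\<close>
    over \<open>f\<close>, chosen so that its value of \<open>B\<close> does not exceed
    \<open>0.2475\<^sup>2 * a\<close>.\<close>
  have n1: "F 0.125 > - 0.0820" by (rule n[where g = "0.81"]) (simp_all add: power_eq_if)
  have n2: "F 0.324 > - 0.04052" by (rule n[where g = "0.864"]) (simp_all add: power_eq_if)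
  have n3: "F 0.483 > - 0.01603" by (rule n[where g = "0.889"]) (simp_all add: power_eq_if)
  have n4: "F 0.785 > 0.02085" by (rule n[where g = "0.921"]) (simp_all add: power_eq_if)
  have n5: "F 1 > 0.04278" by (rule n[where g = "0.9377"]) (simp_all add: power_eq_if)
  define t where "t = (\<lambda>z y. barrier_source z +
    (0.4384 - 1.2688 * z + 1.722 * z\<^sup>2 - 0.8064 * z ^ 3) * (y - z))"
  \<comment> \<open>\<open>z\<close> is the contact point of the tangent. It suffices to compare the
    tangent with the numerical bounds \<open>m\<close> and \<open>m'\<close> at the two
    ends.\<close>
  have piece: "barrier_source y < F y"
    if "0 \<le> z" "z \<le> 1" "a < c" "a \<le> y" "y \<le> c" "F a > m" "F c > m'" "t z a \<le> m" "t z c \<le> m'" for z a c m m'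
  proof -
    define S where "S = 0.4384 - 1.2688 * z + 1.722 * z\<^sup>2 - 0.8064 * z ^ 3"
    define P where "P = barrier_source z - S * z"
    have t: "t z x = P + S * x" for x 
    proof -
      have "t z x = barrier_source z + S * (x - z)" by (simp only: t_def S_def)
      then show ?thesis by (simp add: P_def algebra_simps)
    qed
    have "barrier_source y \<le> P + S * y"
      using barrier_source_tangent[OF y that(1,2), folded S_def] by (simp add: P_def algebra_simps)
    also have "\<dots> < F y"
      unfolding F_def using that f by (intro chord_bound[of f a c y]) (auto simp: F_def t)
    finally show ?thesis .
  qed
  consider "y \<le> 0.125" | "0.125 \<le> y" "y \<le> 0.324" | "0.324 \<le> y" "y \<le> 0.483"
    | "0.483 \<le> y" "y \<le> 0.785" | "0.785 \<le> y" by linarith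
  then have "barrier_source y < F y"
  proof cases
    case 1 show ?thesis
      by (rule piece[OF _ _ _ y(1) 1 n0 n1, of "0.02"]) (simp_all add: t_def barrier_source_def power_eq_if)
  next
    case 2 show ?thesis
      by (rule piece[OF _ _ _ 2 n1 n2, of "0.26"]) (simp_all add: t_def barrier_source_def power_eq_if)
  next
    case 3 show ?thesis
      by (rule piece[OF _ _ _ 3 n2 n3, of "0.4"]) (simp_all add: t_def barrier_source_def power_eq_if)
  next
    case 4 show ?thesis
      by (rule piece[OF _ _ _ 4 n3 n4, of "0.61"]) (simp_all add: t_def barrier_source_def power_eq_if)
  next
    case 5 show ?thesis
      by (rule piece[OF _ _ _ 5 y(2) n4 n5, of "0.91"]) (simp_all add: t_def barrier_source_def power_eq_if)
  qed
  then show ?thesis by (simp add: F_def)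
qed

subsection \<open>Nonexistence\<close>

text \<open>Extracts two orders of differentiability of a local extension, which is what
  second-order operators require.\<close>

lemma smooth_on_extension:
  assumes "smooth_on f M" "p \<in> M"
  obtains U F where "open U" "p \<in> U" "\<And>z. z \<in> U \<Longrightarrow> F differentiable (at z)"
    "\<And>z v. z \<in> U \<Longrightarrow> (\<lambda>z. frechet_derivative F (at z) v) differentiable (at z)"
    "\<And>z. z \<in> M \<Longrightarrow> z \<in> U \<Longrightarrow> F z = f z"
proof -
  obtain U F where U: "open U" "p \<in> U" "\<forall>n. times_differentiable_on n F U" "\<forall>z\<in>M \<inter> U. F z = f z"
    using bspec[OF assms(1)[unfolded smooth_on_def] assms(2)] by (elim exE conjE)
  have "(\<forall>z\<in>U. F differentiable (at z)) \<and>
      (\<forall>v. \<forall>z\<in>U. (\<lambda>z. frechet_derivative F (at z) v) differentiable (at z))"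
    using spec[OF U(3), of "Suc (Suc 0)"] by simp
  then show ?thesis
    using U(1,2,4) by (intro that[of U F]) simp_all
qed

lemma smooth_on_imp_continuous_on:
  assumes "smooth_on f M"
  shows "continuous_on M f"
  unfolding continuous_on_def
proof
  fix p assume p: "p \<in> M"
  obtain U F where U: "open U" "p \<in> U" "\<And>z. z \<in> U \<Longrightarrow> F differentiable (at z)"
      and eq: "\<And>z. z \<in> M \<Longrightarrow> z \<in> U \<Longrightarrow> F z = f z"
    using smooth_on_extension[OF assms p] by metis
  have "isCont F p" using U differentiable_imp_continuous_within by blast
  then have "(F \<longlongrightarrow> f p) (at p within M)"
    using eq[OF p U(2)] by (auto simp: isCont_def intro: tendsto_within_subset)
  moreover have "\<forall>\<^sub>F z in at p within M. F z = f z"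
    using U eq by (auto simp: eventually_at_topological)
  ultimately show "(f \<longlongrightarrow> f p) (at p within M)"
    by (simp add: tendsto_cong)
qed

text \<open>Freezing \<open>\<alpha>\<close> in a local extension on the product gives a local
  extension of the slice, to which \<open>sphere_twice_diff_extension\<close> applies.\<close>

lemma smooth_on_sphere_slice:
  assumes "smooth_on (\<lambda>(x, \<alpha>). \<phi> x \<alpha>) (sphere 0 1 \<times> UNIV)" "norm x = 1"
  shows "sphere_twice_diff (\<lambda>y. \<phi> y \<alpha>) x"
proof -
  obtain U F where U: "open U" "(x, \<alpha>) \<in> U" and F: "\<And>z. z \<in> U \<Longrightarrow> F differentiable (at z)"
      and F': "\<And>z v. z \<in> U \<Longrightarrow> (\<lambda>z. frechet_derivative F (at z) v) differentiable (at z)"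
      and eq: "\<And>z. z \<in> sphere 0 1 \<times> UNIV \<Longrightarrow> z \<in> U \<Longrightarrow> F z = (case z of (x, \<alpha>) \<Rightarrow> \<phi> x \<alpha>)"
    using smooth_on_extension[OF assms(1), of "(x, \<alpha>)"] assms(2) by auto
  define V where "V = (\<lambda>y. (y, \<alpha>)) -` U"
  have emb: "((\<lambda>y. (y, \<alpha>)) has_derivative (\<lambda>h. (h, 0))) (at y)" for y :: "real^3"
    by (auto intro!: derivative_eq_intros)
  have V: "open V" "x \<in> V"
    unfolding V_def using U by (auto intro!: open_vimage continuous_intros)
  have F1: "((\<lambda>y. F (y, \<alpha>)) has_derivative (\<lambda>h. frechet_derivative F (at (y, \<alpha>)) (h, 0))) (at y)" if "y \<in> V" for y
    using diff_chain_at[OF emb, of F "frechet_derivative F (at (y, \<alpha>))"] that F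
    by (auto simp: V_def comp_def frechet_derivative_works)
  show ?thesis
  proof (rule sphere_twice_diff_extension[OF assms(2) V, of "\<lambda>y. F (y, \<alpha>)"])
    show "(\<lambda>y. F (y, \<alpha>)) differentiable (at y)" if "y \<in> V" for y
      using F1[OF that] by (auto simp: differentiable_def)
    fix j :: 3
    have "(\<lambda>y. frechet_derivative F (at (y, \<alpha>)) (axis j 1, 0)) differentiable (at x)"
      using differentiable_chain_at[of "\<lambda>y. (y, \<alpha>)" x "\<lambda>z. frechet_derivative F (at z) (axis j 1, 0)"]
        emb F'[OF U(2)] by (auto simp: comp_def differentiable_def)
    then obtain E where "((\<lambda>y. frechet_derivative F (at (y, \<alpha>)) (axis j 1, 0)) has_derivative E) (at x)"
      by (auto simp: differentiable_def)
    then have "((\<lambda>y. frechet_derivative (\<lambda>y. F (y, \<alpha>)) (at y) (axis j 1)) has_derivative E) (at x)"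
      by (rule has_derivative_transform_within_open[OF _ V])
        (simp add: frechet_derivative_at[OF F1, symmetric])
    then show "(\<lambda>y. frechet_derivative (\<lambda>y. F (y, \<alpha>)) (at y) (axis j 1)) differentiable (at x)"
      by (auto simp: differentiable_def)
  qed (use eq in \<open>auto simp: V_def\<close>)
qed

text \<open>The line through \<open>(x, \<alpha>)\<close> in the circle direction stays in the
  product, so a local extension shows that both applications of \<open>deriv\<close> are genuine
  derivatives near or at \<open>\<alpha>\<close>.\<close>

lemma second_deriv_nonneg_at_min:
  assumes "smooth_on (\<lambda>(x, \<alpha>). \<phi> x \<alpha>) (sphere 0 1 \<times> UNIV)" "norm x = 1"
    and min: "\<And>t. \<phi> x \<alpha> \<le> \<phi> x t"
  shows "(deriv ^^ 2) (\<phi> x) \<alpha> \<ge> 0"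
proof -
  obtain U F where U: "open U" "(x, \<alpha>) \<in> U" and F: "\<And>z. z \<in> U \<Longrightarrow> F differentiable (at z)"
      and F': "\<And>z v. z \<in> U \<Longrightarrow> (\<lambda>z. frechet_derivative F (at z) v) differentiable (at z)"
      and eq: "\<And>z. z \<in> sphere 0 1 \<times> UNIV \<Longrightarrow> z \<in> U \<Longrightarrow> F z = (case z of (x, \<alpha>) \<Rightarrow> \<phi> x \<alpha>)"
    using smooth_on_extension[OF assms(1), of "(x, \<alpha>)"] assms(2) by auto
  define V where "V = (\<lambda>t. (x, t)) -` U"
  have V: "open V" "\<alpha> \<in> V"
    unfolding V_def using U by (auto intro!: open_vimage continuous_intros)
  have along: "((\<lambda>t. f (x, t)) has_real_derivative frechet_derivative f (at (x, t)) (0, 1)) (at t)"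
    if "f differentiable (at (x, t))" for f t
  proof -
    let ?D = "frechet_derivative f (at (x, t))"
    have D: "(f has_derivative ?D) (at (x, t))" using that by (simp add: frechet_derivative_works)
    have "((\<lambda>t. (x, t)) has_derivative (\<lambda>h. (0, h))) (at t)"
      by (auto intro!: derivative_eq_intros)
    from diff_chain_at[OF this D] have "((\<lambda>t. f (x, t)) has_derivative (\<lambda>h. ?D (0, h))) (at t)"
      by (simp add: comp_def)
    moreover have "?D (0, h) = ?D (0, 1) * h" for h
      using linear_scale[OF has_derivative_linear[OF D], of h "(0, 1)"] by simp
    then have "(\<lambda>h. ?D (0, h)) = (*) (?D (0, 1))" by (rule ext)
    ultimately show ?thesis by (simp only: has_field_derivative_def)
  qed
  have p: "(\<phi> x has_real_derivative frechet_derivative F (at (x, t)) (0, 1)) (at t)" if "t \<in> V" for t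
    by (rule has_field_derivative_transform_within_open[OF along V(1) that])
      (use that F[of "(x, t)"] eq[of "(x, _)"] assms(2) in \<open>simp_all add: V_def\<close>)
  define c where "c = frechet_derivative (\<lambda>z. frechet_derivative F (at z) (0, 1)) (at (x, \<alpha>)) (0, 1)"
  have "(deriv (\<phi> x) has_real_derivative c) (at \<alpha>)"
    unfolding c_def
    by (rule has_field_derivative_transform_within_open[OF along V])
      (use F'[OF U(2)] DERIV_imp_deriv[OF p] in simp_all)
  moreover have "\<forall>\<^sub>F t in nhds \<alpha>. (\<phi> x has_real_derivative deriv (\<phi> x) t) (at t)"
    using eventually_nhds_in_open[OF V]
  proof eventually_elim
    case (elim t)
    from p[OF elim] show ?case by (simp add: DERIV_imp_deriv)
  qed
  ultimately have "c \<ge> 0" using min by (intro second_derivative_test(2)) auto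
  moreover have "(deriv ^^ 2) (\<phi> x) \<alpha> = c"
    using \<open>(deriv (\<phi> x) has_real_derivative c) (at \<alpha>)\<close> by (simp add: DERIV_imp_deriv numeral_2_eq_2)
  ultimately show ?thesis by simp
qed

text \<open>With \<open>y = 1 - u\<^sup>2\<close> one has
  \<open>- \<Delta> y^k = 2k(2k+1) y^k - 4k^2 y^(k-1)\<close>. Solving
  \<open>- \<Delta> \<psi> = barrier_source y\<close> from the top degree down gives these
  coefficients; the mean-zero condition makes the constant term match.\<close>

definition barrier :: "real \<Rightarrow> real" where
  "barrier u = (168 * (1 - u\<^sup>2) - 74 * (1 - u\<^sup>2)\<^sup>2 + 47 * (1 - u\<^sup>2) ^ 3 - 14 * (1 - u\<^sup>2) ^ 4) / 5000"

lemma sphere_laplacian_barrier: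
  assumes x: "norm x = 1"
  shows "sphere_twice_diff (\<lambda>y. barrier (y $ 3)) x"
    and "sphere_laplacian (\<lambda>y. barrier (y $ 3)) x = - barrier_source (1 - (x $ 3)\<^sup>2)"
proof -
  define g' where "g' = (\<lambda>u::real. - 2 * u * (168 - 148 * (1 - u\<^sup>2) + 141 * (1 - u\<^sup>2)\<^sup>2 - 56 * (1 - u\<^sup>2) ^ 3) / 5000)"
  define g2 where "g2 = (\<lambda>u::real. - 2 * (168 - 148 * (1 - u\<^sup>2) + 141 * (1 - u\<^sup>2)\<^sup>2 - 56 * (1 - u\<^sup>2) ^ 3) / 5000
     + 4 * u\<^sup>2 * (- 148 + 282 * (1 - u\<^sup>2) - 168 * (1 - u\<^sup>2)\<^sup>2) / 5000)"
  have g: "(barrier has_real_derivative g' t) (at t)" for t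
    unfolding barrier_def[abs_def] g'_def by (auto intro!: derivative_eq_intros) (algebra | simp add: field_simps power_eq_if)
  have g': "(g' has_real_derivative g2 t) (at t)" for t
    unfolding g2_def g'_def by (auto intro!: derivative_eq_intros) (algebra | simp add: field_simps power_eq_if)
  note z = sphere_zonal[OF x open_UNIV UNIV_I g g']
  show "sphere_twice_diff (\<lambda>y. barrier (y $ 3)) x" by (rule z)
  define y where "y = 1 - (x $ 3)\<^sup>2"
  have "(x $ 3)\<^sup>2 = 1 - y" by (simp add: y_def)
  show "sphere_laplacian (\<lambda>y. barrier (y $ 3)) x = - barrier_source (1 - (x $ 3)\<^sup>2)"
    unfolding z(2) g'_def g2_def barrier_source_def by (simp add: field_simps power_eq_if)
qed

lemma periodic_of_int:
  fixes f :: "real \<Rightarrow> 'a"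
  assumes "\<And>t. f (t + T) = f t"
  shows "f (t + of_int k * T) = f t"
proof (induction k arbitrary: t rule: int_induct[where k = 0])
  case (step1 i)
  have "f (t + of_int (i + 1) * T) = f (t + of_int i * T + T)" by (simp add: algebra_simps)
  then show ?case using assms step1 by simp
next
  case (step2 i)
  have "f (t + of_int (i - 1) * T) = f (t + of_int (i - 1) * T + T)" using assms by simp
  also have "\<dots> = f (t + of_int i * T)" by (simp add: algebra_simps)
  finally show ?case using step2 by simp
qed simp

text \<open>At the minimum, \<open>- \<phi>'' - \<Delta> \<phi>\<close> is at most
  \<open>barrier_source\<close>, while the equation and \<open>barrier_source_less\<close> make it
  strictly larger. Monotonicity in \<open>b\<^sup>2\<close> reduces all larger \<open>b\<close> to
  the threshold 0.2475.\<close>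

lemma no_smooth_positive_solution:
  assumes T: "T > 0" and b: "0.2475\<^sup>2 \<le> b\<^sup>2"
    and \<phi>: "smooth_positive T \<phi>"
  shows "\<not> lichnerowicz b \<phi>"
proof
  assume eq: "lichnerowicz b \<phi>"
  have per: "\<phi> x (\<alpha> + T) = \<phi> x \<alpha>" and pos: "\<phi> x \<alpha> > 0" if "norm x = 1" for x \<alpha>
    using \<phi> that by (auto simp: smooth_positive_def)
  have smooth: "smooth_on (\<lambda>(x, \<alpha>). \<phi> x \<alpha>) (sphere 0 1 \<times> UNIV)"
    using \<phi> by (simp add: smooth_positive_def)
  define d where "d = (\<lambda>(x, \<alpha>). \<phi> x \<alpha> - barrier (x $ 3))"
  define K where "K = sphere (0 :: real^3) 1 \<times> {0..T}"
  have "compact K" unfolding K_def by (intro compact_Times) auto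
  moreover have "(axis 3 1, 0) \<in> K" using T by (simp add: K_def)
  moreover have "continuous_on K d"
  proof -
    have "continuous_on K (\<lambda>(x, \<alpha>). \<phi> x \<alpha>)"
      using smooth_on_imp_continuous_on[OF smooth] by (rule continuous_on_subset) (auto simp: K_def)
    then show ?thesis
      unfolding d_def barrier_def case_prod_unfold by (intro continuous_intros) auto
  qed
  ultimately obtain p where p: "p \<in> K" "\<And>q. q \<in> K \<Longrightarrow> d p \<le> d q"
    using continuous_attains_inf[of K d] by blast
  obtain x \<alpha> where x\<alpha>: "p = (x, \<alpha>)" by force
  have x: "norm x = 1" using p x\<alpha> by (simp add: K_def)
  have min: "d p \<le> d (y, t)" if y: "norm y = 1" for y t
  proof -
    \<comment> \<open>Periodicity shifts \<open>t\<close> into the compact domain \<open>K\<close>,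
      on which the minimum was taken; the barrier is constant in \<open>t\<close>.\<close>
    define k where "k = \<lfloor>t / T\<rfloor>"
    have "of_int k \<le> t / T" "t / T < of_int k + 1" by (auto simp: k_def)
    then have "0 \<le> t + of_int (- k) * T" "t + of_int (- k) * T \<le> T"
      using T by (auto simp: field_simps)
    then have "d p \<le> d (y, t + of_int (- k) * T)"
      using y by (intro p) (auto simp: K_def)
    also have "\<dots> = d (y, t)"
      using periodic_of_int[of "\<phi> y" T t "- k"] per[OF y] by (simp add: d_def)
    finally show ?thesis .
  qed
  define y where "y = 1 - (x $ 3)\<^sup>2"
  have "\<bar>x $ 3\<bar> \<le> 1" using component_le_norm_cart[of x 3] x by simp
  then have y: "0 \<le> y" "y \<le> 1" "-1 \<le> x $ 3" "x $ 3 \<le> 1"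
    by (auto simp: y_def abs_square_le_1)
  have sin: "(sin (polar_angle x))\<^sup>2 = y"
    using y by (simp add: polar_angle_def sin_arccos y_def abs_square_le_1)
  define f where "f = \<phi> x \<alpha>"
  have f: "f > 0" using pos x by (simp add: f_def)
  have "0 \<le> sphere_laplacian (\<lambda>y. \<phi> y \<alpha> - barrier (y $ 3)) x"
    using min x\<alpha> x smooth
    by (intro sphere_laplacian_nonneg_at_min sphere_twice_diff_diff)
       (auto simp: d_def smooth_on_sphere_slice sphere_laplacian_barrier)
  also have "\<dots> = sphere_laplacian (\<lambda>y. \<phi> y \<alpha>) x + barrier_source y"
    using x smooth by (simp add: sphere_laplacian_diff smooth_on_sphere_slice sphere_laplacian_barrier y_def)
  finally have "sphere_laplacian (\<lambda>y. \<phi> y \<alpha>) x \<ge> - barrier_source y" by simp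
  moreover have "(deriv ^^ 2) (\<phi> x) \<alpha> \<ge> 0"
    using min[OF x] x\<alpha> by (intro second_deriv_nonneg_at_min[OF smooth x]) (auto simp: d_def)
  moreover have "- (deriv ^^ 2) (\<phi> x) \<alpha> - (sphere_laplacian (\<lambda>y. \<phi> y \<alpha>) x - 1/4 * f)
      - 1/4 * f ^ 5 - b\<^sup>2 * y / f ^ 7 = 0"
    using eq x sin unfolding lichnerowicz_def f_def by (metis dist_0_norm mem_sphere)
  moreover have "barrier_source y < f ^ 5 / 4 + 0.2475\<^sup>2 * y / f ^ 7 - f / 4"
    using barrier_source_less f y by blast
  moreover have "0.2475\<^sup>2 * y / f ^ 7 \<le> b\<^sup>2 * y / f ^ 7"
    using b y f by (intro divide_right_mono mult_right_mono) auto
  ultimately show False by linarith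
qed

subsection \<open>Power series with weighted summable coefficients\<close>

unbundle no vec_syntax
unbundle fps_syntax

text \<open>Bounding all partial sums avoids separate summability conditions.\<close>
definition fps_norm_le :: "real \<Rightarrow> real fps \<Rightarrow> real \<Rightarrow> bool" where
  "fps_norm_le r f C \<longleftrightarrow> (\<forall>M. (\<Sum>n<M. \<bar>f $ n\<bar> * r ^ n) \<le> C)"

lemma fps_norm_le_nonneg: "fps_norm_le r f C \<Longrightarrow> 0 \<le> C"
  unfolding fps_norm_le_def by (metis lessThan_0 sum.empty)

lemma fps_norm_le_mono: "fps_norm_le r f C \<Longrightarrow> C \<le> D \<Longrightarrow> fps_norm_le r f D"
  unfolding fps_norm_le_def using order_trans by blast

lemma fps_norm_le_uminus [simp]: "fps_norm_le r (- f) C \<longleftrightarrow> fps_norm_le r f C"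
  by (simp add: fps_norm_le_def)

lemma fps_norm_le_add:
  assumes "r \<ge> 0" "fps_norm_le r f C" "fps_norm_le r g D"
  shows "fps_norm_le r (f + g) (C + D)"
  unfolding fps_norm_le_def
proof
  fix M
  have "(\<Sum>n<M. \<bar>(f + g) $ n\<bar> * r ^ n) \<le> (\<Sum>n<M. \<bar>f $ n\<bar> * r ^ n + \<bar>g $ n\<bar> * r ^ n)"
    using assms(1) by (intro sum_mono) (simp add: distrib_right[symmetric] mult_right_mono)
  also have "\<dots> \<le> C + D"
    using assms(2,3) by (simp add: sum.distrib fps_norm_le_def add_mono)
  finally show "(\<Sum>n<M. \<bar>(f + g) $ n\<bar> * r ^ n) \<le> C + D" .
qed

lemma fps_norm_le_diff:
  assumes "r \<ge> 0" "fps_norm_le r f C" "fps_norm_le r g D"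
  shows "fps_norm_le r (f - g) (C + D)"
  using fps_norm_le_add[OF assms(1,2), of "- g" D] assms(3) by simp

lemma fps_norm_le_0: "C \<ge> 0 \<Longrightarrow> fps_norm_le r 0 C"
  by (simp add: fps_norm_le_def)

text \<open>The index pairs with \<open>i + j < M\<close> form a triangle inside the square of side
  \<open>M\<close>. This truncated form is also what the bound for inverses rests on.\<close>

lemma fps_norm_le_mult_truncated:
  fixes f g :: "real fps"
  assumes "r \<ge> 0"
  shows "(\<Sum>n<M. \<bar>(f * g) $ n\<bar> * r ^ n) \<le> (\<Sum>n<M. \<bar>f $ n\<bar> * r ^ n) * (\<Sum>n<M. \<bar>g $ n\<bar> * r ^ n)"
proof -
  let ?a = "\<lambda>i j. (\<bar>f $ i\<bar> * r ^ i) * (\<bar>g $ j\<bar> * r ^ j)"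
  have "(\<Sum>n<M. \<bar>(f * g) $ n\<bar> * r ^ n) \<le> (\<Sum>n<M. \<Sum>i\<le>n. ?a i (n - i))"
  proof (rule sum_mono)
    fix n assume "n \<in> {..<M}"
    have "\<bar>(f * g) $ n\<bar> * r ^ n \<le> (\<Sum>i\<le>n. \<bar>f $ i * g $ (n - i)\<bar>) * r ^ n"
      using assms by (intro mult_right_mono) (auto simp: fps_mult_nth atLeast0AtMost)
    also have "\<dots> = (\<Sum>i\<le>n. ?a i (n - i))"
      unfolding sum_distrib_right
    proof (rule sum.cong)
      fix i assume "i \<in> {..n}"
      then have "r ^ n = r ^ i * r ^ (n - i)" by (simp add: power_add[symmetric])
      then show "\<bar>f $ i * g $ (n - i)\<bar> * r ^ n = ?a i (n - i)" by (simp add: abs_mult)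
    qed simp
    finally show "\<bar>(f * g) $ n\<bar> * r ^ n \<le> (\<Sum>i\<le>n. ?a i (n - i))" .
  qed
  also have "\<dots> = (\<Sum>(i, j)\<in>{(i, j). i + j < M}. ?a i j)"
    by (simp add: sum.triangle_reindex)
  also have "\<dots> \<le> (\<Sum>(i, j)\<in>{..<M} \<times> {..<M}. ?a i j)"
    using assms by (intro sum_mono2) auto
  also have "\<dots> = (\<Sum>n<M. \<bar>f $ n\<bar> * r ^ n) * (\<Sum>n<M. \<bar>g $ n\<bar> * r ^ n)"
    by (simp add: sum_product sum.cartesian_product)
  finally show ?thesis .
qed

lemma fps_norm_le_mult:
  assumes "r \<ge> 0" "fps_norm_le r f C" "fps_norm_le r g D"
  shows "fps_norm_le r (f * g) (C * D)"
  unfolding fps_norm_le_def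
proof
  fix M
  have "(\<Sum>n<M. \<bar>(f * g) $ n\<bar> * r ^ n) \<le> (\<Sum>n<M. \<bar>f $ n\<bar> * r ^ n) * (\<Sum>n<M. \<bar>g $ n\<bar> * r ^ n)"
    by (rule fps_norm_le_mult_truncated[OF assms(1)])
  also have "\<dots> \<le> C * D"
    using assms fps_norm_le_nonneg[OF assms(2)]
    by (intro mult_mono) (auto simp: fps_norm_le_def intro!: sum_nonneg)
  finally show "(\<Sum>n<M. \<bar>(f * g) $ n\<bar> * r ^ n) \<le> C * D" .
qed

lemma fps_norm_le_X_power:
  assumes "r \<ge> 0"
  shows "fps_norm_le r (fps_X ^ k) (r ^ k)"
  unfolding fps_norm_le_def
proof
  fix M
  have "(\<Sum>n<M. \<bar>(fps_X ^ k :: real fps) $ n\<bar> * r ^ n) = (\<Sum>n\<in>{..<M} \<inter> {k}. r ^ k)"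
    by (rule sum.mono_neutral_cong_right) auto
  also have "\<dots> \<le> r ^ k" using assms by (cases "k < M") (auto simp: Int_absorb1)
  finally show "(\<Sum>n<M. \<bar>(fps_X ^ k :: real fps) $ n\<bar> * r ^ n) \<le> r ^ k" .
qed

lemma fps_norm_le_1: "r \<ge> 0 \<Longrightarrow> fps_norm_le r 1 1"
  using fps_norm_le_X_power[of r 0] by simp

lemma fps_norm_le_const:
  assumes "\<bar>c\<bar> \<le> C"
  shows "fps_norm_le r (fps_const c) C"
  unfolding fps_norm_le_def
proof
  fix M
  have "(\<Sum>n<M. \<bar>fps_const c $ n\<bar> * r ^ n) = (\<Sum>n\<in>{..<M} \<inter> {0}. \<bar>c\<bar>)"
    by (rule sum.mono_neutral_cong_right) auto
  also have "\<dots> \<le> C" using assms by (cases "0 < M") (auto simp: Int_absorb1)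
  finally show "(\<Sum>n<M. \<bar>fps_const c $ n\<bar> * r ^ n) \<le> C" .
qed

lemma fps_norm_le_const_mult:
  assumes "r \<ge> 0" "fps_norm_le r f C"
  shows "fps_norm_le r (fps_const c * f) (\<bar>c\<bar> * C)"
  by (rule fps_norm_le_mult[OF assms(1) fps_norm_le_const assms(2)]) simp

lemma fps_norm_le_power:
  assumes "r \<ge> 0" "fps_norm_le r f C"
  shows "fps_norm_le r (f ^ n) (C ^ n)"
  by (induction n) (use assms in \<open>auto intro: fps_norm_le_mult fps_norm_le_1\<close>)

text \<open>Lipschitz bound for powers on a ball, by telescoping \<open>f ^ n - g ^ n\<close> one
  factor at a time.\<close>

lemma fps_norm_le_power_diff:
  assumes r: "r \<ge> 0" and f: "fps_norm_le r f C" and g: "fps_norm_le r g C" and D: "fps_norm_le r (f - g) D"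
  shows "fps_norm_le r (f ^ Suc n - g ^ Suc n) (real (Suc n) * C ^ n * D)"
proof (induction n)
  case 0
  then show ?case using D by simp
next
  case (Suc n)
  have "fps_norm_le r (f * (f ^ Suc n - g ^ Suc n) + (f - g) * g ^ Suc n)
      (C * (real (Suc n) * C ^ n * D) + D * C ^ Suc n)"
    by (intro fps_norm_le_add fps_norm_le_mult fps_norm_le_power r f g D Suc)
  moreover have "f * (f ^ Suc n - g ^ Suc n) + (f - g) * g ^ Suc n = f ^ Suc (Suc n) - g ^ Suc (Suc n)"
    by (simp add: algebra_simps)
  moreover have "C * (real (Suc n) * C ^ n * D) + D * C ^ Suc n = real (Suc (Suc n)) * C ^ Suc n * D"
    by (simp add: algebra_simps)
  ultimately show ?case by simp
qed

lemma fps_norm_le_nth: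
  assumes "r \<ge> 1" "fps_norm_le r f C"
  shows "\<bar>f $ n\<bar> \<le> C"
proof -
  have "\<bar>f $ n\<bar> \<le> \<bar>f $ n\<bar> * r ^ n" using assms(1) by (simp add: mult_le_cancel_left1)
  also have "\<dots> \<le> (\<Sum>i<Suc n. \<bar>f $ i\<bar> * r ^ i)"
    using assms(1) by (intro member_le_sum) auto
  also have "\<dots> \<le> C" using assms(2) unfolding fps_norm_le_def by blast
  finally show ?thesis .
qed

text \<open>Each partial sum involves finitely many coefficients, so bounds survive coefficientwise
  limits. This replaces completeness of the norm.\<close>

lemma fps_norm_le_limit:
  assumes f: "\<forall>\<^sub>F k in sequentially. fps_norm_le r (f k) C"
    and lim: "\<And>n. (\<lambda>k. f k $ n) \<longlonglongrightarrow> g $ n"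
  shows "fps_norm_le r g C"
  unfolding fps_norm_le_def
proof
  fix M
  have "(\<lambda>k. \<Sum>n<M. \<bar>f k $ n\<bar> * r ^ n) \<longlonglongrightarrow> (\<Sum>n<M. \<bar>g $ n\<bar> * r ^ n)"
    by (intro tendsto_intros lim)
  then show "(\<Sum>n<M. \<bar>g $ n\<bar> * r ^ n) \<le> C"
    by (rule tendsto_upperbound) (use f in \<open>auto simp: fps_norm_le_def elim: eventually_mono\<close>)
qed

text \<open>Geometric series: \<open>q = inverse (1 + v)\<close> satisfies \<open>q = 1 - v * q\<close>, so already the truncated
  norms \<open>Q\<close> of \<open>q\<close> satisfy \<open>Q \<le> 1 + d * Q\<close>.\<close>
lemma fps_norm_le_inverse:
  assumes r: "r \<ge> 1" and v: "fps_norm_le r v d" and d: "d < 1"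
  shows "inverse (1 + v) * (1 + v) = 1" and "fps_norm_le r (inverse (1 + v)) (1 / (1 - d))"
proof -
  have "\<bar>v $ 0\<bar> \<le> d" by (rule fps_norm_le_nth[OF r v])
  then have "(1 + v) $ 0 \<noteq> 0" using d by auto
  then show q: "inverse (1 + v) * (1 + v) = 1" by (rule inverse_mult_eq_1)
  define q where "q = inverse (1 + v)"
  have q: "q = 1 - v * q" using q by (simp add: q_def algebra_simps)
  show "fps_norm_le r (inverse (1 + v)) (1 / (1 - d))"
    unfolding fps_norm_le_def q_def[symmetric]
  proof
    fix M
    define Q where "Q = (\<Sum>n<M. \<bar>q $ n\<bar> * r ^ n)"
    have Q0: "Q \<ge> 0" unfolding Q_def using r by (intro sum_nonneg) auto
    have "Q \<le> (\<Sum>n<M. \<bar>1 $ n\<bar> * r ^ n + \<bar>(v * q) $ n\<bar> * r ^ n)"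
      unfolding Q_def using r
      by (subst q, intro sum_mono) (simp add: distrib_right[symmetric] mult_right_mono del: fps_one_nth)
    also have "\<dots> \<le> 1 + (\<Sum>n<M. \<bar>v $ n\<bar> * r ^ n) * Q"
      unfolding Q_def sum.distrib using r fps_norm_le_1[of r] 
      by (intro add_mono fps_norm_le_mult_truncated) (auto simp: fps_norm_le_def)
    also have "\<dots> \<le> 1 + d * Q"
      using v Q0 by (intro add_left_mono mult_right_mono) (auto simp: fps_norm_le_def)
    finally show "Q \<le> 1 / (1 - d)" using d by (simp add: field_simps)
  qed
qed

lemma fps_norm_le_conv_radius:
  assumes r: "r > 0" and f: "fps_norm_le r f C"
  shows "fps_conv_radius f \<ge> r"
proof -
  have "summable (\<lambda>n. norm (f $ n * r ^ n))"
    using r f by (intro bounded_imp_summable[of _ C])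
      (auto simp: fps_norm_le_def abs_mult lessThan_Suc_atMost[symmetric] simp del: sum.lessThan_Suc)
  then have "summable (\<lambda>n. f $ n * r ^ n)" by (rule summable_norm_cancel)
  from conv_radius_geI[OF this] show ?thesis using r by (simp add: fps_conv_radius_def)
qed

lemma fps_norm_le_eval:
  assumes r: "r > 0" and f: "fps_norm_le r f C" and z: "\<bar>z\<bar> < r"
  shows "\<bar>eval_fps f z\<bar> \<le> C"
proof -
  have "norm z < fps_conv_radius f"
    using z fps_norm_le_conv_radius[OF r f] by (simp add: order_less_le_trans[of "ereal \<bar>z\<bar>" "ereal r"])
  then have "(\<lambda>M. \<Sum>n<M. f $ n * z ^ n) \<longlonglongrightarrow> eval_fps f z"
    using sums_eval_fps[of z f] by (simp add: sums_def)
  then have "(\<lambda>M. \<bar>\<Sum>n<M. f $ n * z ^ n\<bar>) \<longlonglongrightarrow> \<bar>eval_fps f z\<bar>" by (rule tendsto_rabs)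
  then show ?thesis
  proof (rule LIMSEQ_le_const2, intro exI allI impI)
    fix M :: nat
    have "\<bar>\<Sum>n<M. f $ n * z ^ n\<bar> \<le> (\<Sum>n<M. \<bar>f $ n * z ^ n\<bar>)" by (rule sum_abs)
    also have "\<dots> \<le> (\<Sum>n<M. \<bar>f $ n\<bar> * r ^ n)"
      using z by (intro sum_mono) (auto simp: abs_mult power_abs intro!: mult_left_mono power_mono)
    also have "\<dots> \<le> C" using f by (simp add: fps_norm_le_def)
    finally show "\<bar>\<Sum>n<M. f $ n * z ^ n\<bar> \<le> C" .
  qed
qed

subsection \<open>Inverting the linearised operator\<close>

text \<open>The operator \<open>- \<Delta> - 1\<close> on functions of
  \<open>X = cos \<theta>\<close>, the linearisation of the equation with \<open>b = 0\<close> at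
  the solution 1.\<close>

definition zonal_op :: "real fps \<Rightarrow> real fps" where
  "zonal_op f = fps_const 2 * (fps_X * fps_deriv f) - (1 - fps_X ^ 2) * fps_deriv (fps_deriv f) - f"

text \<open>Only the coefficients \<open>n\<close> and \<open>n + 2\<close> of \<open>f\<close>
  enter, so the operator commutes with coefficientwise limits.\<close>

lemma zonal_op_nth:
  "zonal_op f $ n = (real n ^ 2 + real n - 1) * f $ n - real (n + 2) * real (n + 1) * f $ (n + 2)"
proof (cases "n < 2")
  case True
  then have "n = 0 \<or> n = 1" by auto
  then show ?thesis
    by (auto simp: zonal_op_def algebra_simps fps_X_power_mult_nth numeral_2_eq_2)
next
  case False
  then obtain m where n: "n = m + 2" by (metis add.commute le_Suc_ex not_less)
  show ?thesis
    unfolding zonal_op_def n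
    by (simp add: algebra_simps fps_X_power_mult_nth numeral_2_eq_2 power2_eq_square)
qed

lemma zonal_op_add: "zonal_op (f + g) = zonal_op f + zonal_op g"
  by (rule fps_ext) (simp add: zonal_op_nth algebra_simps)

lemma zonal_op_const_mult: "zonal_op (fps_const c * f) = fps_const c * zonal_op f"
  by (rule fps_ext) (simp add: zonal_op_nth algebra_simps)

lemma zonal_op_X_power:
  "zonal_op (fps_X ^ (m + 2)) = fps_const (real (m + 2) ^ 2 + real (m + 2) - 1) * fps_X ^ (m + 2)
     - fps_const (real (m + 2) * real (m + 1)) * fps_X ^ m"
proof (rule fps_ext)
  have X: "(fps_X ^ k :: real fps) $ j = (if j = k then 1 else 0)" for j k by simp
  show "zonal_op (fps_X ^ (m + 2)) $ n = (fps_const (real (m + 2) ^ 2 + real (m + 2) - 1) * fps_X ^ (m + 2)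
     - fps_const (real (m + 2) * real (m + 1)) * fps_X ^ m) $ n" for n
    unfolding zonal_op_nth fps_sub_nth fps_mult_left_const_nth X
    by (cases "n = m"; cases "n = m + 2") simp_all
qed

text \<open>Polynomial preimages of the monomials by back substitution in steps of two degrees. The
  diagonal entries \<open>m^2 + m - 1\<close> have no integer root; they are -1 and 1 for
  \<open>m = 0\<close> and \<open>m = 1\<close>, whence the initial values.\<close>

fun zonal_sol :: "nat \<Rightarrow> real fps" where
  "zonal_sol 0 = - 1"
| "zonal_sol (Suc 0) = fps_X"
| "zonal_sol (Suc (Suc m)) = fps_const (1 / (real (m + 2) ^ 2 + real (m + 2) - 1)) *
     (fps_X ^ (m + 2) + fps_const (real (m + 2) * real (m + 1)) * zonal_sol m)"

lemma zonal_op_sol: "zonal_op (zonal_sol m) = fps_X ^ m"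
proof (induction m rule: zonal_sol.induct)
  case 1 show ?case by (rule fps_ext) (auto simp: zonal_op_nth)
next
  case 2 show ?case by (rule fps_ext) (auto simp: zonal_op_nth)
next
  case (3 m)
  define l where "l = real (m + 2) ^ 2 + real (m + 2) - 1"
  have "l = real m * real m + 5 * real m + 5" by (simp add: l_def power2_eq_square algebra_simps)
  moreover have "real m * real m \<ge> 0" by simp
  ultimately have "l \<noteq> 0" by linarith
  have "zonal_op (zonal_sol (Suc (Suc m))) =
      fps_const (1 / l) * (zonal_op (fps_X ^ (m + 2)) + fps_const (real (m + 2) * real (m + 1)) * fps_X ^ m)"
    unfolding zonal_sol.simps l_def by (simp only: zonal_op_const_mult zonal_op_add 3)
  also have "\<dots> = fps_const (1 / l) * (fps_const l * fps_X ^ (m + 2))"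
    unfolding zonal_op_X_power l_def by simp
  also have "\<dots> = fps_X ^ Suc (Suc m)"
    using \<open>l \<noteq> 0\<close> by (simp add: mult.assoc[symmetric])
  finally show ?case .
qed

text \<open>The key bound on the inverse of the operator: the \<open>m\<close>-th column is diagonally dominant,
  since \<open>1 + m * (m - 1) \<le> m^2 + m - 1\<close> for \<open>m > 0\<close>.\<close>
lemma fps_norm_le_zonal_sol:
  assumes r: "r \<ge> 1"
  shows "fps_norm_le r (zonal_sol m) (r ^ m)"
proof (induction m rule: zonal_sol.induct)
  case 1 show ?case using r by (simp add: fps_norm_le_1)
next
  case 2 show ?case using r fps_norm_le_X_power[of r 1] by simp
next
  case (3 m)
  define l where "l = real (m + 2) ^ 2 + real (m + 2) - 1"
  define k where "k = real (m + 2) * real (m + 1)"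
  have "l = real m * real m + 5 * real m + 5" by (simp add: l_def power2_eq_square algebra_simps)
  moreover have "real m * real m \<ge> 0" by simp
  ultimately have l: "l > 0" by linarith
  have "fps_norm_le r (fps_const (1 / l) * (fps_X ^ (m + 2) + fps_const k * zonal_sol m))
      (\<bar>1 / l\<bar> * (r ^ (m + 2) + \<bar>k\<bar> * r ^ m))"
    using r 3 by (intro fps_norm_le_const_mult fps_norm_le_add fps_norm_le_X_power) auto
  moreover have "\<bar>1 / l\<bar> * (r ^ (m + 2) + \<bar>k\<bar> * r ^ m) \<le> r ^ (m + 2)"
  proof -
    \<comment> \<open>Here \<open>r \<ge> 1\<close> enters: lowering the degree by two does not
      increase the weight. Then \<open>1 + k \<le> l\<close> finishes the estimate.\<close>
    have "r ^ m \<le> r ^ (m + 2)" using r by (intro power_increasing) auto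
    then have "r ^ (m + 2) + k * r ^ m \<le> r ^ (m + 2) + k * r ^ (m + 2)"
      by (intro add_left_mono mult_left_mono) (auto simp: k_def)
    also have "\<dots> = (1 + k) * r ^ (m + 2)" by (simp add: algebra_simps)
    also have "\<dots> \<le> l * r ^ (m + 2)"
      using r by (intro mult_right_mono) (auto simp: k_def l_def power2_eq_square algebra_simps)
    finally have "r ^ (m + 2) + k * r ^ m \<le> l * r ^ (m + 2)" .
    moreover have "k \<ge> 0" by (simp add: k_def)
    ultimately show ?thesis using l by (simp add: divide_le_eq mult.commute)
  qed
  ultimately show ?case unfolding zonal_sol.simps l_def[symmetric] k_def[symmetric]
    by (auto intro: fps_norm_le_mono)
qed

text \<open>Superposition of the monomial preimages. Even a single coefficient is an infinite
  series, since preimages of arbitrarily high degree contribute to it.\<close>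

definition zonal_inv :: "real fps \<Rightarrow> real fps" where
  "zonal_inv h = Abs_fps (\<lambda>n. \<Sum>m. h $ m * zonal_sol m $ n)"

lemma summable_zonal_inv:
  assumes r: "r \<ge> 1" and h: "fps_norm_le r h C"
  shows "summable (\<lambda>m. h $ m * zonal_sol m $ n)"
proof (rule summable_comparison_test)
  show "summable (\<lambda>m. \<bar>h $ m\<bar> * r ^ m)"
    using r h by (intro bounded_imp_summable[of _ C])
      (auto simp: fps_norm_le_def lessThan_Suc_atMost[symmetric] simp del: sum.lessThan_Suc)
  show "\<exists>N. \<forall>m\<ge>N. norm (h $ m * zonal_sol m $ n) \<le> \<bar>h $ m\<bar> * r ^ m"
    using fps_norm_le_nth[OF r fps_norm_le_zonal_sol[OF r]] by (auto simp: abs_mult intro!: mult_left_mono)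
qed

text \<open>The finite superpositions \<open>S K\<close> have norm at most \<open>C\<close> by the
  column bound and are mapped to truncations of \<open>h\<close>. Both facts pass to the
  coefficientwise limit.\<close>

lemma zonal_inv:
  assumes r: "r \<ge> 1" and h: "fps_norm_le r h C"
  shows "zonal_op (zonal_inv h) = h" and "fps_norm_le r (zonal_inv h) C"
proof -
  define S where "S = (\<lambda>K. \<Sum>m<K. fps_const (h $ m) * zonal_sol m)"
  have S_nth: "S K $ n = (\<Sum>m<K. h $ m * zonal_sol m $ n)" for K n
    by (simp add: S_def fps_sum_nth)
  have lim: "(\<lambda>K. S K $ n) \<longlonglongrightarrow> zonal_inv h $ n" for n
    using summable_LIMSEQ[OF summable_zonal_inv[OF r h]] by (simp add: S_nth zonal_inv_def)
  have "fps_norm_le r (S K) (\<Sum>m<K. \<bar>h $ m\<bar> * r ^ m)" for K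
  proof (induction K)
    case 0
    then show ?case by (simp add: S_def fps_norm_le_0)
  next
    case (Suc K)
    have "fps_norm_le r (S K + fps_const (h $ K) * zonal_sol K) ((\<Sum>m<K. \<bar>h $ m\<bar> * r ^ m) + \<bar>h $ K\<bar> * r ^ K)"
      using r by (intro fps_norm_le_add fps_norm_le_const_mult Suc fps_norm_le_zonal_sol) auto
    then show ?case by (simp add: S_def)
  qed
  then have "fps_norm_le r (S K) C" for K
    using h by (auto simp: fps_norm_le_def[of r h] intro: fps_norm_le_mono)
  then show "fps_norm_le r (zonal_inv h) C"
    using lim by (intro fps_norm_le_limit[where f = S]) auto
  have S: "zonal_op (S K) $ n = (if n < K then h $ n else 0)" for K n
  proof (induction K)
    case 0
    then show ?case by (simp add: S_def zonal_op_nth)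
  next
    case (Suc K)
    have "zonal_op (S (Suc K)) = zonal_op (S K) + fps_const (h $ K) * fps_X ^ K"
      by (simp add: S_def zonal_op_add zonal_op_const_mult zonal_op_sol)
    then show ?case using Suc by (auto simp: less_Suc_eq)
  qed
  show "zonal_op (zonal_inv h) = h"
  proof (rule fps_ext)
    fix n
    have "(\<lambda>K. zonal_op (S K) $ n) \<longlonglongrightarrow> zonal_op (zonal_inv h) $ n"
      unfolding zonal_op_nth by (intro tendsto_intros lim)
    moreover have "(\<lambda>K. zonal_op (S K) $ n) \<longlonglongrightarrow> h $ n"
      using eventually_gt_at_top[of n]
      by (intro tendsto_eventually, eventually_elim) (simp add: S)
    ultimately show "zonal_op (zonal_inv h) $ n = h $ n" by (rule LIMSEQ_unique)
  qed
qed

lemma zonal_inv_diff: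
  assumes "r \<ge> 1" "fps_norm_le r f C" "fps_norm_le r g D"
  shows "zonal_inv f - zonal_inv g = zonal_inv (f - g)"
  by (rule fps_ext)
    (simp add: zonal_inv_def left_diff_distrib suminf_diff summable_zonal_inv[OF assms(1,2)]
      summable_zonal_inv[OF assms(1,3)])

subsection \<open>Existence\<close>

text \<open>Picard iteration from 0 with a limit taken coefficientwise. The norm is present only
  through its upper bounds, so contraction is stated for every bound \<open>D\<close>.\<close>

lemma fps_contraction_fixed_point:
  fixes \<Phi> :: "real fps \<Rightarrow> real fps"
  assumes r: "r \<ge> 1" and d: "d \<ge> 0"
    and ball: "\<And>v. fps_norm_le r v d \<Longrightarrow> fps_norm_le r (\<Phi> v) d"
    and contr: "\<And>v w D. fps_norm_le r v d \<Longrightarrow> fps_norm_le r w d \<Longrightarrow> fps_norm_le r (v - w) D \<Longrightarrow>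
       fps_norm_le r (\<Phi> v - \<Phi> w) (D / 2)"
  obtains v where "fps_norm_le r v d" "\<Phi> v = v"
proof -
  define V where "V = (\<lambda>k. (\<Phi> ^^ k) 0)"
  have V_Suc: "V (Suc k) = \<Phi> (V k)" for k by (simp add: V_def)
  have V0: "V 0 = 0" by (simp add: V_def)
  have V: "fps_norm_le r (V k) d" for k
    by (induction k) (use d ball in \<open>auto simp: V_def fps_norm_le_0\<close>)
  have step: "fps_norm_le r (V (Suc k) - V k) (d * (1 / 2) ^ k)" for k
  proof (induction k)
    case 0
    then show ?case using V[of 1] by (simp add: V_def)
  next
    case (Suc k)
    then show ?case using contr[OF V V Suc] by (simp add: V_Suc)
  qed
  have far: "fps_norm_le r (V (k + j) - V k) (2 * d * (1 / 2) ^ k)" for k j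
  proof -
    \<comment> \<open>The exact sum of the geometric step bounds lets the induction on
      \<open>j\<close> close.\<close>
    have "fps_norm_le r (V (k + j) - V k) (2 * d * (1 / 2) ^ k - 2 * d * (1 / 2) ^ (k + j))"
    proof (induction j)
      case 0
      then show ?case by (simp add: fps_norm_le_0)
    next
      case (Suc j)
      have "fps_norm_le r ((V (Suc (k + j)) - V (k + j)) + (V (k + j) - V k))
         (d * (1 / 2) ^ (k + j) + (2 * d * (1 / 2) ^ k - 2 * d * (1 / 2) ^ (k + j)))"
        using r by (intro fps_norm_le_add step Suc) auto
      then show ?case by simp
    qed
    then show ?thesis by (rule fps_norm_le_mono) (use d in simp)
  qed
  have "convergent (\<lambda>k. V k $ n)" for n
  proof -
    have "summable (\<lambda>k. V (Suc k) $ n - V k $ n)"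
    proof (rule summable_comparison_test)
      show "summable (\<lambda>k. d * (1 / 2 :: real) ^ k)" by (intro summable_mult summable_geometric) simp
      show "\<exists>N. \<forall>k\<ge>N. norm (V (Suc k) $ n - V k $ n) \<le> d * (1 / 2) ^ k"
        using fps_norm_le_nth[OF r step] by auto
    qed
    then have "convergent (\<lambda>k. \<Sum>i<k. V (Suc i) $ n - V i $ n)"
      by (simp add: summable_iff_convergent)
    moreover have "(\<lambda>k. \<Sum>i<k. V (Suc i) $ n - V i $ n) = (\<lambda>k. V k $ n)"
      using sum_lessThan_telescope[of "\<lambda>i. V i $ n"] by (simp add: V0)
    ultimately show ?thesis by simp
  qed
  then have "\<forall>n. \<exists>l. (\<lambda>k. V k $ n) \<longlonglongrightarrow> l" by (simp add: convergent_def)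
  then obtain l where l: "\<And>n. (\<lambda>k. V k $ n) \<longlonglongrightarrow> l n" by metis
  define v where "v = Abs_fps l"
  have lim: "(\<lambda>k. V k $ n) \<longlonglongrightarrow> v $ n" for n using l by (simp add: v_def)
  have v: "fps_norm_le r v d" using V lim by (intro fps_norm_le_limit[where f = V]) auto
  have near: "fps_norm_le r (v - V k) (2 * d * (1 / 2) ^ k)" for k
  proof (rule fps_norm_le_limit)
    show "\<forall>\<^sub>F j in sequentially. fps_norm_le r (V (k + j) - V k) (2 * d * (1 / 2) ^ k)"
      using far by simp
    show "(\<lambda>j. (V (k + j) - V k) $ n) \<longlonglongrightarrow> (v - V k) $ n" for n
      using LIMSEQ_ignore_initial_segment[OF lim[of n], of k] by (auto intro!: tendsto_intros simp: add.commute)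
  qed
  \<comment> \<open>The contraction property makes \<open>\<Phi>\<close> continuous at
    \<open>v\<close>, so the shifted iterates also converge to \<open>\<Phi> v\<close>.\<close>
  have "(\<lambda>k. V (Suc k) $ n) \<longlonglongrightarrow> \<Phi> v $ n" for n
  proof (rule LIM_zero_cancel, rule Lim_null_comparison)
    show "\<forall>\<^sub>F k in sequentially. norm (V (Suc k) $ n - \<Phi> v $ n) \<le> 2 * d * (1 / 2) ^ k / 2"
      using fps_norm_le_nth[OF r contr[OF v V near]]
      by (simp add: V_Suc abs_minus_commute)
    show "(\<lambda>k. 2 * d * (1 / 2) ^ k / 2) \<longlonglongrightarrow> 0"
      by (auto intro!: tendsto_eq_intros LIMSEQ_power_zero)
  qed
  moreover have "(\<lambda>k. V (Suc k) $ n) \<longlonglongrightarrow> v $ n" for n using lim LIMSEQ_Suc by blast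
  ultimately have "\<Phi> v = v" by (intro fps_ext) (metis LIMSEQ_unique)
  with v that show ?thesis by blast
qed

text \<open>The remainder after moving the linear part to the left:
  \<open>((1 + v)^5 - (1 + v)) / 4 - v\<close>, plus the source with
  \<open>\<beta> = b\<^sup>2\<close> and \<open>1 - X^2\<close> for
  \<open>(sin \<theta>)^2\<close>.\<close>

definition zonal_source :: "real \<Rightarrow> real fps \<Rightarrow> real fps" where
  "zonal_source \<beta> v = fps_const (1 / 4) * (fps_const 10 * v ^ 2 + fps_const 10 * v ^ 3 + fps_const 5 * v ^ 4 + v ^ 5) +
     fps_const \<beta> * ((1 - fps_X ^ 2) * inverse (1 + v) ^ 7)"

lemma fps_norm_le_one_minus_X2:
  "fps_norm_le (5 / 4) (1 - fps_X ^ 2) (41 / 16)"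
  by (rule fps_norm_le_mono[OF fps_norm_le_diff[OF _ fps_norm_le_1 fps_norm_le_X_power]])
     (simp_all add: power2_eq_square)

text \<open>The weight is \<open>5 / 4\<close>, the radius \<open>1 / 40\<close>, and
  \<open>40 / 39 = 1 / (1 - 1 / 40)\<close> bounds the inverse of \<open>1 + v\<close>. The
  resulting bound is about 0.0195, below \<open>1 / 40\<close>.\<close>

lemma zonal_source_ball:
  assumes \<beta>: "0 \<le> \<beta>" "\<beta> \<le> 0.00586" and v: "fps_norm_le (5 / 4) v (1 / 40)"
  shows "fps_norm_le (5 / 4) (zonal_source \<beta> v) (1 / 40)"
proof -
  have q: "fps_norm_le (5 / 4) (inverse (1 + v)) (40 / 39)"
    using fps_norm_le_inverse(2)[OF _ v] by simp
  have "fps_norm_le (5 / 4) (zonal_source \<beta> v)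
     (\<bar>1 / 4\<bar> * (\<bar>10\<bar> * (1 / 40) ^ 2 + \<bar>10\<bar> * (1 / 40) ^ 3 + \<bar>5\<bar> * (1 / 40) ^ 4 + (1 / 40) ^ 5) + \<bar>\<beta>\<bar> * (41 / 16 * (40 / 39) ^ 7))"
    unfolding zonal_source_def
    by (intro fps_norm_le_add fps_norm_le_const_mult fps_norm_le_mult fps_norm_le_power v q fps_norm_le_one_minus_X2) auto
  moreover have "\<bar>\<beta>\<bar> * (41 / 16 * (40 / 39) ^ 7) \<le> 0.00586 * (41 / 16 * (40 / 39) ^ 7)"
    using \<beta> by (intro mult_right_mono) auto
  ultimately show ?thesis
    by (rule fps_norm_le_mono[OF _ order_trans[OF add_left_mono]]) (simp add: power_eq_if)
qed

text \<open>The Lipschitz bounds for the powers and for the inverse add up to a constant of about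
  0.26.\<close>

lemma zonal_source_contr:
  assumes \<beta>: "0 \<le> \<beta>" "\<beta> \<le> 0.00586" and v: "fps_norm_le (5 / 4) v (1 / 40)" and w: "fps_norm_le (5 / 4) w (1 / 40)"
    and D: "fps_norm_le (5 / 4) (v - w) D"
  shows "fps_norm_le (5 / 4) (zonal_source \<beta> v - zonal_source \<beta> w) (D / 2)"
proof -
  define p q where "p = inverse (1 + v)" and "q = inverse (1 + w)"
  have p: "fps_norm_le (5 / 4) p (40 / 39)" and q: "fps_norm_le (5 / 4) q (40 / 39)"
    using fps_norm_le_inverse(2)[OF _ v] fps_norm_le_inverse(2)[OF _ w] by (simp_all add: p_def q_def)
  have "p * (1 + v) = 1" "q * (1 + w) = 1"
    using fps_norm_le_inverse(1)[OF _ v] fps_norm_le_inverse(1)[OF _ w] by (simp_all add: p_def q_def)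
  \<comment> \<open>The resolvent identity gives the Lipschitz bound for the inverse.\<close>
  then have "p - q = - ((v - w) * (p * q))" by algebra
  then have pq: "fps_norm_le (5 / 4) (p - q) (D * (40 / 39 * (40 / 39)))"
    by (simp only: fps_norm_le_uminus) (intro fps_norm_le_mult D p q; simp)
  have pow: "fps_norm_le (5 / 4) (v ^ n - w ^ n) (real n * (1 / 40) ^ (n - 1) * D)" if "n > 0" for n
    using fps_norm_le_power_diff[OF _ v w D, of "n - 1"] that by simp
  have pow7: "fps_norm_le (5 / 4) (p ^ 7 - q ^ 7) (7 * (40 / 39) ^ 6 * (D * (40 / 39 * (40 / 39))))"
    using fps_norm_le_power_diff[OF _ p q pq, of 6] by simp
  have eq: "zonal_source \<beta> v - zonal_source \<beta> w = fps_const (1 / 4) * (fps_const 10 * (v ^ 2 - w ^ 2) + fps_const 10 * (v ^ 3 - w ^ 3) +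
      fps_const 5 * (v ^ 4 - w ^ 4) + (v ^ 5 - w ^ 5)) + fps_const \<beta> * ((1 - fps_X ^ 2) * (p ^ 7 - q ^ 7))"
    unfolding zonal_source_def p_def q_def by algebra
  have "fps_norm_le (5 / 4) (zonal_source \<beta> v - zonal_source \<beta> w)
     (\<bar>1 / 4\<bar> * (\<bar>10\<bar> * (real 2 * (1 / 40) ^ (2 - 1) * D) + \<bar>10\<bar> * (real 3 * (1 / 40) ^ (3 - 1) * D) +
        \<bar>5\<bar> * (real 4 * (1 / 40) ^ (4 - 1) * D) + real 5 * (1 / 40) ^ (5 - 1) * D) +
      \<bar>\<beta>\<bar> * (41 / 16 * (7 * (40 / 39) ^ 6 * (D * (40 / 39 * (40 / 39))))))"
    unfolding eq
    by (intro fps_norm_le_add fps_norm_le_const_mult fps_norm_le_mult pow pow7 fps_norm_le_one_minus_X2) auto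
  moreover have "\<bar>\<beta>\<bar> * (41 / 16 * (7 * (40 / 39) ^ 6 * (D * (40 / 39 * (40 / 39))))) \<le>
      0.00586 * (41 / 16 * (7 * (40 / 39) ^ 6 * (D * (40 / 39 * (40 / 39)))))"
    using \<beta> fps_norm_le_nonneg[OF D] by (intro mult_right_mono) auto
  moreover have "D \<ge> 0" by (rule fps_norm_le_nonneg[OF D])
  ultimately show ?thesis
    by (rule_tac fps_norm_le_mono[OF _ order_trans[OF add_left_mono]]) (assumption+, simp add: power_eq_if)
qed

lemma zonal_fixed_point:
  assumes "0 \<le> \<beta>" "\<beta> \<le> 0.00586"
  obtains v where "fps_norm_le (5 / 4) v (1 / 40)" "zonal_op v = zonal_source \<beta> v"
proof (rule fps_contraction_fixed_point[of "5 / 4" "1 / 40" "\<lambda>v. zonal_inv (zonal_source \<beta> v)"])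
  show "fps_norm_le (5 / 4) (zonal_inv (zonal_source \<beta> v)) (1 / 40)" if "fps_norm_le (5 / 4) v (1 / 40)" for v
    using zonal_source_ball[OF assms that] by (intro zonal_inv(2)) auto
  show "fps_norm_le (5 / 4) (zonal_inv (zonal_source \<beta> v) - zonal_inv (zonal_source \<beta> w)) (D / 2)"
    if "fps_norm_le (5 / 4) v (1 / 40)" "fps_norm_le (5 / 4) w (1 / 40)" "fps_norm_le (5 / 4) (v - w) D" for v w D
    using zonal_source_contr[OF assms that] zonal_source_ball[OF assms that(1)] zonal_source_ball[OF assms that(2)]
    by (subst zonal_inv_diff[of "5 / 4"]) (auto intro: zonal_inv(2))
  show thesis if "fps_norm_le (5 / 4) v (1 / 40)" "zonal_inv (zonal_source \<beta> v) = v" for v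
    using that(1) zonal_inv(1)[OF _ zonal_source_ball[OF assms that(1)]] that(2) by (intro \<open>_ \<Longrightarrow> _ \<Longrightarrow> thesis\<close>[of v]) auto
qed auto

section \<open>Evaluating the power series solution\<close>

lemma less_fps_conv_radius_add:
  "R < fps_conv_radius f \<Longrightarrow> R < fps_conv_radius g \<Longrightarrow> R < fps_conv_radius (f + g)"
  using fps_conv_radius_add[of f g] by (meson less_le_trans min_less_iff_conj)

lemma less_fps_conv_radius_diff:
  "R < fps_conv_radius f \<Longrightarrow> R < fps_conv_radius g \<Longrightarrow> R < fps_conv_radius (f - g)"
  using fps_conv_radius_diff[of f g] by (meson less_le_trans min_less_iff_conj)

lemma less_fps_conv_radius_mult:
  fixes f g :: "real fps"
  shows "R < fps_conv_radius f \<Longrightarrow> R < fps_conv_radius g \<Longrightarrow> R < fps_conv_radius (f * g)"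
  using fps_conv_radius_mult[of f g] by (meson less_le_trans min_less_iff_conj)

lemma less_fps_conv_radius_power:
  fixes f :: "real fps"
  shows "R < fps_conv_radius f \<Longrightarrow> R < fps_conv_radius (f ^ n)"
  using fps_conv_radius_power[of f n] by (meson less_le_trans)

lemma less_fps_conv_radius_deriv:
  fixes f :: "real fps"
  shows "R < fps_conv_radius f \<Longrightarrow> R < fps_conv_radius (fps_deriv f)"
  using fps_conv_radius_deriv[of f] by (meson less_le_trans)

lemmas less_fps_conv_radius = less_fps_conv_radius_add less_fps_conv_radius_diff
  less_fps_conv_radius_mult less_fps_conv_radius_power less_fps_conv_radius_deriv

text \<open>Inside the disc of convergence, evaluation is a ring homomorphism compatible with
  derivatives, so the identity of power series becomes the differential equation. Positivity follows
  from \<open>\<bar>v\<bar> \<le> 1 / 40\<close> pointwise.\<close>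

lemma eval_fps_zonal_solution:
  assumes v: "fps_norm_le (5 / 4) v (1 / 40)" "zonal_op v = zonal_source \<beta> v" and u: "\<bar>u\<bar> < 5 / 4"
  defines "f \<equiv> 1 + v"
  shows "eval_fps f u > 0"
    and "(1 - u\<^sup>2) * eval_fps (fps_deriv (fps_deriv f)) u - 2 * u * eval_fps (fps_deriv f) u =
       1 / 4 * eval_fps f u - 1 / 4 * eval_fps f u ^ 5 - \<beta> * (1 - u\<^sup>2) / eval_fps f u ^ 7"
proof -
  have rad: "ereal (norm u) < fps_conv_radius g" if "fps_norm_le (5 / 4) g C" for g C
    using u fps_norm_le_conv_radius[OF _ that] by (auto intro: less_le_trans[of "ereal \<bar>u\<bar>" "ereal (5 / 4)"])
  define q where "q = inverse (1 + v)"
  have q: "fps_norm_le (5 / 4) q (1 / (1 - 1 / 40))" "q * (1 + v) = 1"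
    using fps_norm_le_inverse[OF _ v(1)] by (simp_all add: q_def)
  note rv = rad[OF v(1)] and rq = rad[OF q(1)]
  define x y z s where "x = eval_fps v u" and "y = eval_fps (fps_deriv v) u"
    and "z = eval_fps (fps_deriv (fps_deriv v)) u" and "s = eval_fps q u"
  have pow: "eval_fps (g ^ n) u = eval_fps g u ^ n" if "ereal (norm u) < fps_conv_radius g" for g :: "real fps" and n
    by (induction n) (use that in \<open>simp_all add: eval_fps_mult less_fps_conv_radius\<close>)
  have "eval_fps (zonal_op v) u = 2 * u * y - (1 - u\<^sup>2) * z - x"
    unfolding zonal_op_def x_def y_def z_def using rv
    by (simp add: eval_fps_diff eval_fps_mult less_fps_conv_radius)
  moreover have "eval_fps (zonal_source \<beta> v) u =
      1 / 4 * (10 * x ^ 2 + 10 * x ^ 3 + 5 * x ^ 4 + x ^ 5) + \<beta> * ((1 - u\<^sup>2) * s ^ 7)"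
    unfolding zonal_source_def q_def[symmetric] x_def s_def using rv rq
    by (simp add: eval_fps_add eval_fps_diff eval_fps_mult pow less_fps_conv_radius)
  ultimately have eq: "2 * u * y - (1 - u\<^sup>2) * z - x =
      1 / 4 * (10 * x ^ 2 + 10 * x ^ 3 + 5 * x ^ 4 + x ^ 5) + \<beta> * ((1 - u\<^sup>2) * s ^ 7)"
    using v(2) by simp
  have "eval_fps (q * (1 + v)) u = s * (1 + x)"
    unfolding x_def s_def using rv rq by (simp add: eval_fps_add eval_fps_mult less_fps_conv_radius)
  then have sx: "s * (1 + x) = 1" using q(2) by simp
  have f: "eval_fps f u = 1 + x" unfolding f_def x_def using rv by (simp add: eval_fps_add)
  have x: "\<bar>x\<bar> \<le> 1 / 40" unfolding x_def using fps_norm_le_eval[OF _ v(1) u] by simp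
  then show "eval_fps f u > 0" using f by auto
  have "s = 1 / (1 + x)" using sx x by (simp add: field_simps)
  then have "\<beta> * ((1 - u\<^sup>2) * s ^ 7) = \<beta> * (1 - u\<^sup>2) / (1 + x) ^ 7" by (simp add: power_divide)
  with eq have eq': "(1 - u\<^sup>2) * z - 2 * u * y =
      - x - 1 / 4 * (10 * x ^ 2 + 10 * x ^ 3 + 5 * x ^ 4 + x ^ 5) - \<beta> * (1 - u\<^sup>2) / (1 + x) ^ 7"
    by linarith
  have "- x - 1 / 4 * (10 * x ^ 2 + 10 * x ^ 3 + 5 * x ^ 4 + x ^ 5) = 1 / 4 * (1 + x) - 1 / 4 * (1 + x) ^ 5"
    by (simp add: field_simps power_eq_if)
  moreover have "eval_fps (fps_deriv f) u = y" "eval_fps (fps_deriv (fps_deriv f)) u = z"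
    by (simp_all add: f_def y_def z_def)
  ultimately show "(1 - u\<^sup>2) * eval_fps (fps_deriv (fps_deriv f)) u - 2 * u * eval_fps (fps_deriv f) u =
       1 / 4 * eval_fps f u - 1 / 4 * eval_fps f u ^ 5 - \<beta> * (1 - u\<^sup>2) / eval_fps f u ^ 7"
    unfolding f using eq' by simp
qed

unbundle no fps_syntax
unbundle vec_syntax

section \<open>Smoothness on the product and conclusion\<close>

lemma times_differentiable_on_cong:
  assumes "open U" "\<And>x. x \<in> U \<Longrightarrow> f x = g x" "times_differentiable_on n f U"
  shows "times_differentiable_on n g U"
  using assms(2,3)
proof (induction n arbitrary: f g)
  case 0
  then show ?case by (simp cong: continuous_on_cong)
next
  case (Suc n)
  have spec2: "\<forall>x\<in>U. f differentiable (at x)" using Suc.prems(2) by simp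
  have D: "(g has_derivative frechet_derivative f (at x)) (at x)" if "x \<in> U" for x
    by (rule has_derivative_transform_within_open[where f = f, OF _ assms(1) that])
      (use Suc.prems(1) that spec2 in \<open>simp_all add: frechet_derivative_works\<close>)
  have "times_differentiable_on n (\<lambda>x. frechet_derivative g (at x) v) U" for v
  proof (rule Suc.IH)
    show "frechet_derivative f (at x) v = frechet_derivative g (at x) v" if "x \<in> U" for x
      using frechet_derivative_at[OF D[OF that]] by simp
    show "times_differentiable_on n (\<lambda>x. frechet_derivative f (at x) v) U"
      using Suc.prems by simp
  qed
  then show ?case using differentiableI[OF D] by simp
qed

text \<open>For a fixed direction \<open>v\<close> the derivative has the same form, with
  \<open>f\<close> replaced by a constant multiple of its derivative, whose radius is no smaller.
  Hence the induction over arbitrary \<open>f\<close>.\<close>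

lemma times_differentiable_on_eval_fps:
  fixes f :: "real fps"
  assumes "fps_conv_radius f \<ge> ereal r"
  shows "times_differentiable_on n (\<lambda>z. eval_fps f (fst z $ 3)) {z :: (real^3) \<times> real. \<bar>fst z $ 3\<bar> < r}"
  using assms
proof (induction n arbitrary: f)
  have opn: "open {z :: (real^3) \<times> real. \<bar>fst z $ 3\<bar> < r}"
    by (intro open_Collect_less continuous_intros)
  have D: "((\<lambda>z :: (real^3) \<times> real. eval_fps f (fst z $ 3)) has_derivative
      (\<lambda>h. eval_fps (fps_deriv f) (fst z $ 3) * fst h $ 3)) (at z)"
    if "\<bar>fst z $ 3\<bar> < r" "fps_conv_radius f \<ge> ereal r" for z and f :: "real fps"
  proof -
    have "ereal (norm (fst z $ 3)) < fps_conv_radius f"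
      using that by (auto intro: less_le_trans[of _ "ereal r"])
    then have e: "(eval_fps f has_derivative (*) (eval_fps (fps_deriv f) (fst z $ 3))) (at (fst z $ 3))"
      using has_field_derivative_eval_fps[of "fst z $ 3" f UNIV] by (simp add: has_field_derivative_def)
    have "((\<lambda>z :: (real^3) \<times> real. fst z $ 3) has_derivative (\<lambda>h. fst h $ 3)) (at z)"
      by (auto intro!: derivative_eq_intros bounded_linear.has_derivative[OF bounded_linear_vec_nth])
    from diff_chain_at[OF this e] show ?thesis by (simp add: comp_def)
  qed
  {
    case 0
    have "isCont (\<lambda>z :: (real^3) \<times> real. eval_fps f (fst z $ 3)) z" if "\<bar>fst z $ 3\<bar> < r" for z
      by (rule has_derivative_continuous[OF D[OF that 0]])
    then show ?case by (auto intro!: continuous_at_imp_continuous_on)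
  next
    case (Suc n)
    have "times_differentiable_on n (\<lambda>z. frechet_derivative (\<lambda>z. eval_fps f (fst z $ 3)) (at z) v) {z :: (real^3) \<times> real. \<bar>fst z $ 3\<bar> < r}"
      for v :: "(real^3) \<times> real"
    proof (rule times_differentiable_on_cong[OF opn])
      have rad: "fps_conv_radius (fps_const c * fps_deriv f) \<ge> ereal r" for c
        using Suc.prems fps_conv_radius_deriv[of f] fps_conv_radius_mult[of "fps_const c" "fps_deriv f"] by auto
      then show "times_differentiable_on n (\<lambda>z. eval_fps (fps_const (fst v $ 3) * fps_deriv f) (fst z $ 3)) {z :: (real^3) \<times> real. \<bar>fst z $ 3\<bar> < r}"
        by (rule Suc.IH)
      fix z :: "(real^3) \<times> real" assume z: "z \<in> {z. \<bar>fst z $ 3\<bar> < r}"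
      have "ereal (norm (fst z $ 3)) < fps_conv_radius (fps_deriv f)"
        using z Suc.prems fps_conv_radius_deriv[of f] by (auto intro: less_le_trans[of _ "ereal r"])
      then have "eval_fps (fps_const (fst v $ 3) * fps_deriv f) (fst z $ 3) = fst v $ 3 * eval_fps (fps_deriv f) (fst z $ 3)"
        by (simp add: eval_fps_mult)
      also have "\<dots> = frechet_derivative (\<lambda>z. eval_fps f (fst z $ 3)) (at z) v"
        using fun_cong[OF frechet_derivative_at[OF D[of z f]], of v] z Suc.prems by (simp add: mult.commute)
      finally show "eval_fps (fps_const (fst v $ 3) * fps_deriv f) (fst z $ 3) =
        frechet_derivative (\<lambda>z. eval_fps f (fst z $ 3)) (at z) v" .
    qed
    moreover have "(\<lambda>z. eval_fps f (fst z $ 3)) differentiable (at z)" if "\<bar>fst z $ 3\<bar> < r" for z :: "(real^3) \<times> real"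
      by (rule differentiableI[OF D[OF that Suc.prems]])
    ultimately show ?case by simp
  }
qed

text \<open>The solution is constant along the circle, hence periodic with every \<open>T\<close>. A
  single slab where the series converges contains the whole sphere, poles included, and gives the
  smooth extension at every point.\<close>

lemma zonal_solution_exists:
  assumes b: "b\<^sup>2 \<le> 0.00586"
  shows "\<exists>\<phi>. smooth_positive T \<phi> \<and> lichnerowicz b \<phi>"
proof -
  obtain v where v: "fps_norm_le (5 / 4) v (1 / 40)" "zonal_op v = zonal_source (b\<^sup>2) v"
    using zonal_fixed_point[of "b\<^sup>2"] b by auto
  define f where "f = 1 + v"
  have "fps_conv_radius v \<ge> ereal (5 / 4)" using fps_norm_le_conv_radius[OF _ v(1)] by simp
  then have rad: "fps_conv_radius f \<ge> ereal (5 / 4)"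
    using fps_conv_radius_add[of 1 v] by (simp add: f_def)
  note sol = eval_fps_zonal_solution[OF v, folded f_def]
  define \<phi> where "\<phi> = (\<lambda>(x::real^3) (\<alpha>::real). eval_fps f (x $ 3))"
  have le1: "\<bar>x $ 3\<bar> < 5 / 4" if "norm x = 1" for x :: "real^3"
    using component_le_norm_cart[of x 3] that by simp
  have "smooth_positive T \<phi>"
    unfolding smooth_positive_def smooth_on_def
  proof (intro conjI ballI allI)
    fix p :: "(real^3) \<times> real" assume p: "p \<in> sphere 0 1 \<times> UNIV"
    show "\<exists>U F. open U \<and> p \<in> U \<and> (\<forall>n. times_differentiable_on n F U) \<and>
        (\<forall>x\<in>sphere 0 1 \<times> UNIV \<inter> U. F x = (case x of (x, \<alpha>) \<Rightarrow> \<phi> x \<alpha>))"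
    proof (intro exI conjI allI ballI)
      show "open {z :: (real^3) \<times> real. \<bar>fst z $ 3\<bar> < 5 / 4}"
        by (intro open_Collect_less continuous_intros)
      show "p \<in> {z :: (real^3) \<times> real. \<bar>fst z $ 3\<bar> < 5 / 4}" using p le1 by auto
      show "times_differentiable_on n (\<lambda>z. eval_fps f (fst z $ 3)) {z :: (real^3) \<times> real. \<bar>fst z $ 3\<bar> < 5 / 4}" for n
        by (rule times_differentiable_on_eval_fps[OF rad])
    qed (auto simp: \<phi>_def)
  qed (use sol(1) le1 in \<open>auto simp: \<phi>_def\<close>)
  moreover have "lichnerowicz b \<phi>"
    unfolding lichnerowicz_def
  proof (intro ballI allI)
    fix x :: "real^3" and \<alpha> :: real assume "x \<in> sphere 0 1"
    then have x: "norm x = 1" by simp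
    define u where "u = x $ 3"
    have "\<bar>u\<bar> \<le> 1" using component_le_norm_cart[of x 3] x by (simp add: u_def)
    then have sin: "(sin (polar_angle x))\<^sup>2 = 1 - u\<^sup>2"
      by (simp add: polar_angle_def u_def sin_arccos abs_square_le_1)
    have der: "(eval_fps g has_real_derivative eval_fps (fps_deriv g) t) (at t)"
      if "t \<in> {-5/4<..<5/4}" "fps_conv_radius g \<ge> ereal (5 / 4)" for t and g :: "real fps"
      using that by (intro has_field_derivative_eval_fps) (auto intro: less_le_trans[of _ "ereal (5 / 4)"])
    have rad': "fps_conv_radius (fps_deriv f) \<ge> ereal (5 / 4)"
      using rad fps_conv_radius_deriv[of f] by (rule order_trans)
    have u: "x $ 3 \<in> {-5/4<..<5/4}" using le1[OF x] by auto
    have "sphere_laplacian (\<lambda>y. \<phi> y \<alpha>) x =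
        (1 - u\<^sup>2) * eval_fps (fps_deriv (fps_deriv f)) u - 2 * u * eval_fps (fps_deriv f) u"
      unfolding \<phi>_def u_def
      by (rule sphere_zonal(2)[OF x _ u der[OF _ rad] der[OF u rad']]) auto
    also have "\<dots> = 1 / 4 * eval_fps f u - 1 / 4 * eval_fps f u ^ 5 - b\<^sup>2 * (1 - u\<^sup>2) / eval_fps f u ^ 7"
      using le1[OF x] by (intro sol(2)) (simp add: u_def)
    finally have "sphere_laplacian (\<lambda>y. \<phi> y \<alpha>) x =
        1 / 4 * \<phi> x \<alpha> - 1 / 4 * \<phi> x \<alpha> ^ 5 - b\<^sup>2 * (1 - u\<^sup>2) / \<phi> x \<alpha> ^ 7"
      by (simp add: \<phi>_def u_def)
    moreover have "(deriv ^^ 2) (\<phi> x) \<alpha> = 0" by (simp add: \<phi>_def numeral_2_eq_2)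
    ultimately show "- (deriv ^^ 2) (\<phi> x) \<alpha> - (sphere_laplacian (\<lambda>y. \<phi> y \<alpha>) x - 1/4 * \<phi> x \<alpha>)
        - 1/4 * \<phi> x \<alpha> ^ 5 - b\<^sup>2 * (sin (polar_angle x))\<^sup>2 / \<phi> x \<alpha> ^ 7 = 0"
      by (simp add: sin)
  qed
  ultimately show ?thesis by blast
qed

theorem theorem3:
  fixes \<Lambda> T J b :: real
  assumes "\<Lambda> > 0" and "T > 0" and "b = 3/2 * J * \<Lambda>"
  shows "(T \<le> 2 * pi \<and> \<Lambda> * \<bar>J\<bar> < 0.05 \<longrightarrow>
           (\<exists>\<phi>. smooth_positive T \<phi> \<and> lichnerowicz b \<phi>)) \<and>
         (T \<ge> 2 * pi \<and> \<Lambda> * \<bar>J\<bar> < 2.01 / T\<^sup>2 \<longrightarrow>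
           (\<exists>\<phi>. smooth_positive T \<phi> \<and> lichnerowicz b \<phi>)) \<and>
         (\<Lambda> * \<bar>J\<bar> > 0.165 \<longrightarrow>
           \<not> (\<exists>\<phi>. smooth_positive T \<phi> \<and> lichnerowicz b \<phi>))"
proof (intro conjI impI)
  have b: "\<bar>b\<bar> = 3 / 2 * (\<Lambda> * \<bar>J\<bar>)" unfolding assms(3) using assms(1) by (simp add: abs_mult)
  \<comment> \<open>0.051 covers both cases: it exceeds 0.05 and also
    \<open>2.01 / 6.28\<^sup>2\<close>, where 6.28 is just below \<open>2 * pi\<close>.\<close>
  have ex: "\<exists>\<phi>. smooth_positive T \<phi> \<and> lichnerowicz b \<phi>" if "\<Lambda> * \<bar>J\<bar> \<le> 0.051"
  proof (rule zonal_solution_exists)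
    have "\<bar>b\<bar> \<le> 0.0765" using b that by simp
    then have "\<bar>b\<bar>\<^sup>2 \<le> 0.0765\<^sup>2" by (intro power_mono) auto
    then show "b\<^sup>2 \<le> 0.00586" by (simp add: power2_eq_square)
  qed
  show "\<exists>\<phi>. smooth_positive T \<phi> \<and> lichnerowicz b \<phi>" if "T \<le> 2 * pi \<and> \<Lambda> * \<bar>J\<bar> < 0.05"
    using that by (intro ex) simp
  show "\<exists>\<phi>. smooth_positive T \<phi> \<and> lichnerowicz b \<phi>" if T: "T \<ge> 2 * pi \<and> \<Lambda> * \<bar>J\<bar> < 2.01 / T\<^sup>2"
  proof (rule ex)
    have "T \<ge> 6.28" using T pi_gt3 pi_approx by auto
    then have "6.28\<^sup>2 \<le> T\<^sup>2" by (intro power_mono) auto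
    then have "2.01 / T\<^sup>2 \<le> 2.01 / 6.28\<^sup>2" by (intro divide_left_mono) (use assms(2) in auto)
    also have "\<dots> \<le> 0.051" by (simp add: power2_eq_square)
    finally show "\<Lambda> * \<bar>J\<bar> \<le> 0.051" using T by simp
  qed
  show "\<not> (\<exists>\<phi>. smooth_positive T \<phi> \<and> lichnerowicz b \<phi>)" if "\<Lambda> * \<bar>J\<bar> > 0.165"
  proof -
    \<comment> \<open>\<open>0.2475 = 3 / 2 * 0.165\<close>.\<close>
    have "\<bar>b\<bar> \<ge> 0.2475" using b that by simp
    then have "0.2475\<^sup>2 \<le> \<bar>b\<bar>\<^sup>2" by (intro power_mono) auto
    then show ?thesis using no_smooth_positive_solution[OF assms(2)] by auto
  qed
qed
end
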